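(* For each $z\in\mathbb Z[\tau]$ there is a unique $w$-NAF $\xi\in\mathcal N^{\mathrm{fin}.0}$ with $\mathrm{value}(\xi)=z$; thus $\mathcal D$ is a width-$w$ non-adjacent digit set. Moreover, the following algorithm terminates for every input $z\in\mathbb Z[\tau]$ and outputs this $w$-NAF: set $\ell\leftarrow0$, $y\leftarrow z$; while $y\ne0$: if $\tau\mid y$ set $\xi_\ell\leftarrow0$, otherwise let $\xi_\ell$ be the element of $\mathcal D$ with $\xi_\ell\equiv y\pmod{\tau^w}$; then set $y\leftarrow(y-\xi_\ell)/\tau$ and $\ell\leftarrow\ell+1$; finally output $\xi_{\ell-1}\dots\xi_1\xi_0$.
   Context: Let $p,q\in\mathbb Z$ with $4q-p^2>0$ and let $\tau$ be a root of $X^2-pX+q$, with $|\tau|>1$; let $w\ge2$ be an integer. Voronoi cell $V=\{z\in\mathbb C:|z|\le|z-y|\ \forall y\in\mathbb Z[\tau]\}$ (a convex polygon). Label its vertices counter-clockwise $v_0,\dots,v_{m-1}$ starting with the vertex of real part $1/2$ and positive imaginary part, indices mod $m$, $v_{k+1/2}$ the midpoint of $v_kv_{k+1}$. The restricted Voronoi cell $\widetilde V$ consists of the interior of $V$, the segments from $v_{k+1/2}$ (excluded) to $v_{k+1}$ (excluded) for all $k$, the points $v_{k+1/2}$ for $0\le k\le\lfloor m/2\rfloor-1$ and the points $v_k$ for $1\le k\le\lfloor m/3\rfloor$; the translates $u+\widetilde V$, $u\in\mathbb Z[\tau]$, partition $\mathbb C$. Digit set $\mathcal D$: $0$ together with,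 for each residue class modulo $\tau^w$ not divisible by $\tau$, its unique element in $\tau^w\widetilde V$. A $w$-NAF is a sequence $(\xi_j)_{j\in\mathbb Z}\in\mathcal D^{\mathbb Z}$ in which each block of $w$ consecutive digits contains at most one nonzero digit; $\mathcal N^{\mathrm{fin}.0}$ is the set of $w$-NAFs with $\xi_j=0$ for all $j<0$ and all but finitely many $j$; $\mathrm{value}(\xi)=\sum_j\xi_j\tau^j$. A digit set is a width-$w$ non-adjacent digit set if every element of $\mathbb Z[\tau]$ has a unique $w$-NAF in $\mathcal N^{\mathrm{fin}.0}$. *)

theory Defs
  imports
    "HOL-Analysis.Analysis"
    "HOL-Computational_Algebra.Polynomial"
    "HOL-Library.While_Combinator"
begin

definition Z_adjoin :: "complex \<Rightarrow> complex set" where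
  "Z_adjoin \<tau> = range (\<lambda>f :: int poly. poly (map_poly of_int f) \<tau>)"

text \<open>Divisibility inside \<open>\<int>[\<tau>]\<close>; the class operation \<open>dvd\<close> on type
  \<^typ>\<open>complex\<close> is divisibility in a field and hence of no use here.\<close>

definition Z_dvd :: "complex \<Rightarrow> complex \<Rightarrow> complex \<Rightarrow> bool" where
  "Z_dvd \<tau> a b \<longleftrightarrow> (\<exists>c \<in> Z_adjoin \<tau>. b = a * c)"

definition Z_cong :: "complex \<Rightarrow> nat \<Rightarrow> complex \<Rightarrow> complex \<Rightarrow> bool" where
  "Z_cong \<tau> w a b \<longleftrightarrow> Z_dvd \<tau> (\<tau> ^ w) (a - b)"

definition voronoi :: "complex \<Rightarrow> complex set" where
  "voronoi \<tau> = {z. \<forall>y \<in> Z_adjoin \<tau>. cmod z \<le> cmod (z - y)}"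

definition voronoi_vertices :: "complex \<Rightarrow> complex set" where
  "voronoi_vertices \<tau> = {v. v extreme_point_of voronoi \<tau>}"

definition start_vertex :: "complex \<Rightarrow> complex" where
  "start_vertex \<tau> = (THE v. v \<in> voronoi_vertices \<tau> \<and> Re v = 1 / 2 \<and> Im v > 0)"

text \<open>The Voronoi cell is convex and has the origin in its interior, so counter-clockwise
  order of its vertices is the order of their angles (in \<open>[0, 2\<pi>)\<close>) measured from the
  start vertex.\<close>

definition vertex_list :: "complex \<Rightarrow> complex list" where
  "vertex_list \<tau> =
     sorted_key_list_of_set (\<lambda>v. Arg2pi (v / start_vertex \<tau>)) (voronoi_vertices \<tau>)"

definition num_vertices :: "complex \<Rightarrow> nat" where
  "num_vertices \<tau> = card (voronoi_vertices \<tau>)"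

definition vertex :: "complex \<Rightarrow> nat \<Rightarrow> complex" where
  "vertex \<tau> k = vertex_list \<tau> ! (k mod num_vertices \<tau>)"

definition edge_midpoint :: "complex \<Rightarrow> nat \<Rightarrow> complex" where
  "edge_midpoint \<tau> k = midpoint (vertex \<tau> k) (vertex \<tau> (k + 1))"

definition restricted_voronoi :: "complex \<Rightarrow> complex set" where
  "restricted_voronoi \<tau> =
     interior (voronoi \<tau>)
     \<union> (\<Union>k < num_vertices \<tau>. open_segment (edge_midpoint \<tau> k) (vertex \<tau> (k + 1)))
     \<union> edge_midpoint \<tau> ` {k. k < num_vertices \<tau> div 2}
     \<union> vertex \<tau> ` {1..num_vertices \<tau> div 3}"

definition residue_class :: "complex \<Rightarrow> nat \<Rightarrow> complex \<Rightarrow> complex set" where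
  "residue_class \<tau> w x = {y \<in> Z_adjoin \<tau>. Z_cong \<tau> w y x}"

definition digits :: "complex \<Rightarrow> nat \<Rightarrow> complex set" where
  "digits \<tau> w =
     insert 0 {the_elem (residue_class \<tau> w x \<inter> (\<lambda>z. \<tau> ^ w * z) ` restricted_voronoi \<tau>) | x.
       x \<in> Z_adjoin \<tau> \<and> \<not> Z_dvd \<tau> \<tau> x}"

definition is_wNAF :: "nat \<Rightarrow> complex set \<Rightarrow> (int \<Rightarrow> complex) \<Rightarrow> bool" where
  "is_wNAF w D \<xi> \<longleftrightarrow>
     (\<forall>j. \<xi> j \<in> D) \<and> (\<forall>k. card {j \<in> {k..<k + int w}. \<xi> j \<noteq> 0} \<le> 1)"

definition wNAF_fin0 :: "nat \<Rightarrow> complex set \<Rightarrow> (int \<Rightarrow> complex) set" where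
  "wNAF_fin0 w D =
     {\<xi>. is_wNAF w D \<xi> \<and> (\<forall>j < 0. \<xi> j = 0) \<and> finite {j. \<xi> j \<noteq> 0}}"

definition naf_value :: "complex \<Rightarrow> (int \<Rightarrow> complex) \<Rightarrow> complex" where
  "naf_value \<tau> \<xi> = (\<Sum>\<^sub>\<infinity>j. \<xi> j * \<tau> powi j)"

definition wNADS :: "complex \<Rightarrow> nat \<Rightarrow> complex set \<Rightarrow> bool" where
  "wNADS \<tau> w D \<longleftrightarrow>
     (\<forall>z \<in> Z_adjoin \<tau>. \<exists>!\<xi>. \<xi> \<in> wNAF_fin0 w D \<and> naf_value \<tau> \<xi> = z)"

definition next_digit :: "complex \<Rightarrow> nat \<Rightarrow> complex \<Rightarrow> complex" where
  "next_digit \<tau> w y =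
     (if Z_dvd \<tau> \<tau> y then 0 else (THE d. d \<in> digits \<tau> w \<and> Z_cong \<tau> w d y))"

text \<open>The state of the loop is \<open>(\<xi>, l, y)\<close>; only the entries \<open>\<xi> 0, \<dots>, \<xi> (l - 1)\<close> have been
  assigned. The result is \<^const>\<open>None\<close> if the loop does not terminate, and otherwise the
  word \<open>\<xi> (l - 1) \<dots> \<xi> 0\<close>, most significant digit first.\<close>

definition naf_algorithm :: "complex \<Rightarrow> nat \<Rightarrow> complex \<Rightarrow> complex list option" where
  "naf_algorithm \<tau> w z =
     map_option (\<lambda>(\<xi>, l, y). rev (map \<xi> [0..<l]))
       (while_option
         (\<lambda>(\<xi>, l, y). y \<noteq> 0)
         (\<lambda>(\<xi>, l, y). (\<xi>(l := next_digit \<tau> w y), l + 1, (y - next_digit \<tau> w y) / \<tau>))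
         ((\<lambda>_. undefined) :: nat \<Rightarrow> complex, 0 :: nat, z))"

definition word_seq :: "complex list \<Rightarrow> int \<Rightarrow> complex" where
  "word_seq ds j = (if 0 \<le> j \<and> j < int (length ds) then rev ds ! nat j else 0)"

end

theory Submission
  imports Defs
begin

text \<open>If \<open>y\<close> is not divisible by \<open>\<tau>\<close>, the choice of the digit \<open>d\<close> in the scaled restricted cell means that
  \<open>y' = (y - d) / \<tau> ^ w\<close> is a lattice point nearest to \<open>y / \<tau> ^ w\<close>. Comparing it with the lattice point
  \<open>0\<close> gives \<open>cmod y' \<le> 2 * cmod y / cmod \<tau> ^ w\<close>, so the integral norm strictly decreases unless
  \<open>q = w = 2\<close> and \<open>y' = 2 * y / \<tau>\<^sup>2\<close>; the latter cannot happen three times in a row, because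
  the restricted cell does not contain two points \<open>\<plusminus> y / 2\<close>. Hence the algorithm terminates. Uniqueness
  holds since the lowest digit of a w-NAF is determined by the residue class of its value.

  Everything rests on the fact that the translates of the restricted cell tile the plane. The
  lattice \<open>\<int>[\<tau>]\<close> is generated by \<open>1\<close> and either \<open>h \<i>\<close> or \<open>1/2 + h \<i>\<close>, according to the parity of
  \<open>p\<close>, so the cell is an explicit rectangle or hexagon.\<close>

section \<open>Half-open rectangles and hexagons\<close>

text \<open>In the smallest case the estimate leaves no room: |\<tau>|^w is at least q, hence at
  least 2. Equal norms then force the scaled digit to be the antipode of y / \<tau>^w, so y is
  multiplied by 2 / \<tau>^2, a number of modulus 1. That it is a root of unity follows from
  divisibility rather than size: if y is not divisible by \<tau> but 2 * y / \<tau>^2 is in the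
  lattice, then p is even, and the positive discriminant leaves p = 0, 2, -2, where the number has
  order 2 or 4. Here the boundary rule is decisive, since y / 2 and -y / 2 may both lie in the
  closed cell. The rule is given through vertices sorted by angle, so the vertices and their order
  have to be computed. Central symmetry halves the sorting, and the rule selects one of each pair of
  half-edges that are lattice translates of each other. The corners form one orbit of four
  (rectangle) or two orbits of three (hexagon), which explains the count m div 3.\<close>

definition rect_cell :: "real \<Rightarrow> real \<Rightarrow> real \<Rightarrow> bool" where
  "rect_cell h x y \<longleftrightarrow>
     \<bar>x\<bar> < 1/2 \<and> \<bar>y\<bar> < h/2 \<or>
     y = h/2 \<and> -1/2 \<le> x \<and> x \<le> 0 \<or>
     x = -1/2 \<and> -h/2 < y \<and> y \<le> 0 \<or>
     y = -h/2 \<and> 0 < x \<and> x < 1/2 \<or>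
     x = 1/2 \<and> 0 < y \<and> y < h/2"

text \<open>The disjuncts after the interior are the kept half-edges, counter-clockwise from the top
  edge; the weak inequalities admit the top and left midpoints and the top left corner. An omitted
  half-edge is carried by a generator onto a kept one on the opposite side. All four corners are
  translates of (-1/2, h/2).\<close>

lemma rect_cell_covers:
  assumes "h > 0" "\<bar>x\<bar> \<le> 1/2" "\<bar>y\<bar> \<le> h/2"
  shows "\<exists>i j :: int. rect_cell h (x - of_int i) (y - of_int j * h)"
proof -
  have *: ?thesis if "rect_cell h (x - of_int i) (y - of_int j * h)" for i j :: int
    using that by blast
  show ?thesis
  proof (cases "rect_cell h x y")
    case True
    then show ?thesis using *[of 0 0] by simp
  next
    case False
    consider "y = h/2" | "y = -h/2" | "\<bar>y\<bar> < h/2" using assms(3) by linarith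
    then show ?thesis
    proof cases
      case 1
      with False assms have "x > 0" by (auto simp: rect_cell_def)
      show ?thesis
      proof (cases "x = 1/2")
        case True
        then show ?thesis using 1 by (intro *[of 1 0]) (simp add: rect_cell_def)
      next
        case False
        then show ?thesis using 1 assms \<open>x > 0\<close> by (intro *[of 0 1]) (simp add: rect_cell_def)
      qed
    next
      case 2
      with False assms have "x \<le> 0 \<or> x = 1/2" by (auto simp: rect_cell_def)
      then show ?thesis
      proof
        assume "x \<le> 0"
        then show ?thesis using 2 assms by (intro *[of 0 "-1"]) (simp add: rect_cell_def)
      next
        assume "x = 1/2"
        then show ?thesis using 2 by (intro *[of 1 "-1"]) (simp add: rect_cell_def)
      qed
    next
      case 3
      have "x = 1/2 \<or> x = -1/2" using assms(2) False 3 by (auto simp: rect_cell_def)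
      then show ?thesis
      proof
        assume "x = 1/2"
        then show ?thesis using False 3 by (intro *[of 1 0]) (auto simp: rect_cell_def)
      next
        assume "x = -1/2"
        then show ?thesis using False 3 by (intro *[of "-1" 0]) (auto simp: rect_cell_def)
      qed
    qed
  qed
qed

lemma rect_cell_bounds:
  assumes "h > 0" "rect_cell h x y"
  shows "\<bar>x\<bar> \<le> 1/2" "\<bar>y\<bar> \<le> h/2"
  using assms by (auto simp: rect_cell_def)

lemma rect_cell_disjoint:
  fixes i j :: int
  assumes "h > 0" "rect_cell h x y" "rect_cell h (x - of_int i) (y - of_int j * h)"
  shows "i = 0 \<and> j = 0"
proof -
  note V = rect_cell_bounds[OF assms(1,2)] rect_cell_bounds[OF assms(1,3)]
  then have "\<bar>real_of_int i\<bar> \<le> 1" by linarith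
  then consider "i = -1" | "i = 0" | "i = 1" by linarith
  note i = this
  have "\<bar>of_int j * h\<bar> \<le> 1 * h" using V by linarith
  then have "\<bar>real_of_int j\<bar> \<le> 1"
    using assms(1) by (simp add: abs_mult)
  then consider "j = -1" | "j = 0" | "j = 1" by linarith
  then show ?thesis using assms by cases (cases rule: i; auto simp: rect_cell_def)+
qed

text \<open>The coordinates are \<open>(x, y) = (Re z, h * Im z)\<close>, in which the cell of the lattice generated
  by \<open>1\<close> and \<open>\<omega> = 1/2 + h \<i>\<close> is cut out by inequalities linear in \<open>n = cmod \<omega> ^ 2 / 2\<close>; there \<open>\<omega>\<close>
  becomes \<open>(1/2, 2 * n - 1/4)\<close>.\<close>

definition hex_cell :: "real \<Rightarrow> real \<Rightarrow> real \<Rightarrow> bool" where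
  "hex_cell n x y \<longleftrightarrow>
     \<bar>x\<bar> < 1/2 \<and> \<bar>x/2 + y\<bar> < n \<and> \<bar>x/2 - y\<bar> < n \<or>
     x/2 + y = n \<and> 0 \<le> x \<and> x \<le> 1/4 \<or>
     y - x/2 = n \<and> -1/2 \<le> x \<and> x \<le> -1/4 \<or>
     x = -1/2 \<and> 1/4 - n < y \<and> y \<le> 0 \<or>
     x/2 + y = -n \<and> -1/4 < x \<and> x < 0 \<or>
     y - x/2 = -n \<and> 1/4 < x \<and> x < 1/2 \<or>
     x = 1/2 \<and> 0 < y \<and> y < n - 1/4"

text \<open>Omitted and kept half-edges are paired across three pairs of opposite edges. The corners
  fall into two orbits of three, alternating around the hexagon and represented by (0, n) and (-1/2,
  n - 1/4).\<close>

lemma hex_cell_covers: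
  assumes "n \<ge> 1/2" "\<bar>x\<bar> \<le> 1/2" "\<bar>x/2 + y\<bar> \<le> n" "\<bar>x/2 - y\<bar> \<le> n"
  shows "\<exists>i j :: int. hex_cell n (x - (of_int i + of_int j / 2)) (y - of_int j * (2 * n - 1/4))"
proof -
  have *: ?thesis if "hex_cell n (x - (of_int i + of_int j / 2)) (y - of_int j * (2 * n - 1/4))" for i j :: int
    using that by blast
  show ?thesis
  proof (cases "hex_cell n x y")
    case True
    then show ?thesis using *[of 0 0] by simp
  next
    case False
    consider "x/2 + y = n" | "y - x/2 = n" | "x/2 + y = -n" | "y - x/2 = -n"
      | "\<bar>x/2 + y\<bar> < n" "\<bar>x/2 - y\<bar> < n" using assms by linarith
    then show ?thesis
    proof cases
      case 1
      with False assms have "x > 1/4" by (auto simp: hex_cell_def)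
      show ?thesis
      proof (cases "x = 1/2")
        case True
        then show ?thesis using 1 assms by (intro *[of 1 0]) (simp add: hex_cell_def field_simps)
      next
        case False
        then show ?thesis using 1 assms \<open>x > 1/4\<close>
          by (intro *[of 0 1]) (simp add: hex_cell_def field_simps)
      qed
    next
      case 2
      with False assms have "x > -1/4" "x < 0" by (auto simp: hex_cell_def)
      then show ?thesis using 2 assms
        by (intro *[of "-1" 1]) (simp add: hex_cell_def field_simps)
    next
      case 3
      with False assms have "x \<le> -1/4 \<or> x = 0" by (auto simp: hex_cell_def)
      then show ?thesis
      proof
        assume "x = 0"
        then show ?thesis using 3 assms by (intro *[of 1 "-1"]) (simp add: hex_cell_def)
      next
        assume "x \<le> -1/4"
        then show ?thesis using 3 assms by (intro *[of 0 "-1"]) (simp add: hex_cell_def field_simps)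
      qed
    next
      case 4
      with False assms have "0 \<le> x" "x \<le> 1/4 \<or> x = 1/2" by (auto simp: hex_cell_def)
      then show ?thesis using 4 assms
        by (intro *[of 1 "-1"]) (auto simp: hex_cell_def field_simps)
    next
      case 5
      have "\<not> \<bar>x\<bar> < 1/2" using False 5 by (auto simp: hex_cell_def)
      with assms(2) have "x = 1/2 \<or> x = -1/2" by argo
      then show ?thesis
      proof
        assume "x = 1/2"
        then show ?thesis using False 5 assms by (intro *[of 1 0]) (auto simp: hex_cell_def)
      next
        assume "x = -1/2"
        then show ?thesis using False 5 assms by (intro *[of "-1" 0]) (auto simp: hex_cell_def)
      qed
    qed
  qed
qed

lemma hex_cell_bounds:
  assumes "n \<ge> 1/2" "hex_cell n x y"
  shows "\<bar>x\<bar> \<le> 1/2" "\<bar>x/2 + y\<bar> \<le> n" "\<bar>x/2 - y\<bar> \<le> n"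
  using assms by (auto simp: hex_cell_def)

text \<open>Only 0 and the six translations across an edge are small enough. For each of the six,
  the strip bounds on the point and on its translate become equalities, so the point lies on a
  shared edge, which the boundary rule assigns to one side only.\<close>

lemma hex_cell_disjoint:
  fixes i j :: int
  assumes n: "n \<ge> 1/2" and a: "hex_cell n x y"
    and b: "hex_cell n (x - (of_int i + of_int j / 2)) (y - of_int j * (2 * n - 1/4))"
  shows "i = 0 \<and> j = 0"
proof -
  \<comment> \<open>The exceptional values x = 0 and y = n - 1/4 are the kept corners v_1 and v_2,
    which also begin the following edge.\<close>
  have edges:
    "x/2 + y = n \<Longrightarrow> 0 \<le> x \<and> x \<le> 1/4"
    "y - x/2 = n \<Longrightarrow> x \<le> -1/4 \<or> x = 0"
    "x/2 + y = -n \<Longrightarrow> -1/4 < x \<and> x < 0"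
    "y - x/2 = -n \<Longrightarrow> 1/4 < x \<and> x < 1/2"
    "x = 1/2 \<Longrightarrow> 0 < y \<and> y < n - 1/4"
    "x = -1/2 \<Longrightarrow> y \<le> 0 \<or> y = n - 1/4" if "hex_cell n x y" for x y
    using that n by (auto simp: hex_cell_def)
  note V = hex_cell_bounds[OF n a] hex_cell_bounds[OF n b]
  have "\<bar>y\<bar> \<le> n" "\<bar>y - of_int j * (2 * n - 1/4)\<bar> \<le> n"
    using V(2,3) V(5,6) by argo+
  \<comment> \<open>Ordinates in the cell differ by at most 2 * n, which is less than two row
    spacings.\<close>
  then have "\<bar>of_int j * (2 * n - 1/4)\<bar> < 2 * (2 * n - 1/4)" using n by argo
  then have "\<bar>real_of_int j\<bar> * (2 * n - 1/4) < 2 * (2 * n - 1/4)"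
    using n by (simp add: abs_mult)
  then have "\<bar>real_of_int j\<bar> < 2"
    by (rule mult_right_less_imp_less) (use n in simp)
  then have j: "j = -1 \<or> j = 0 \<or> j = 1" by linarith
  have "\<bar>real_of_int i + of_int j / 2\<bar> \<le> 1" using V(1,4) by argo
  then have ij: "\<bar>2 * i + j\<bar> \<le> 2" by linarith
  with j have "i = -1 \<or> i = 0 \<or> i = 1" by linarith
  with j ij have "(i, j) \<in> {(0,0), (1,0), (-1,0), (0,1), (-1,1), (0,-1), (1,-1)}"
    by (elim disjE) simp_all
  then consider "i = 0" "j = 0" | "i = 1" "j = 0" | "i = -1" "j = 0" | "i = 0" "j = 1"
    | "i = -1" "j = 1" | "i = 0" "j = -1" | "i = 1" "j = -1"
    by auto
  then show ?thesis
  proof cases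
    case 2
    then have "x = 1/2" using V(1,4) by (simp; argo)
    then show ?thesis using edges(5)[OF a] edges(6)[OF b] 2 by auto
  next
    case 3
    then have "x = -1/2" using V(1,4) by (simp; argo)
    then show ?thesis using edges(6)[OF a] edges(5)[OF b] 3 by auto
  next
    case 4
    then have "x/2 + y = n" using V(2,5) by (simp; argo)
    then show ?thesis using edges(1)[OF a] edges(3)[OF b] 4 by (auto simp: field_simps)
  next
    case 5
    then have "y - x/2 = n" using V(3,6) by (simp; argo)
    then show ?thesis using edges(2)[OF a] edges(4)[OF b] 5 by (auto simp: field_simps)
  next
    case 6
    then have "x/2 + y = - n" using V(2,5) by (simp; argo)
    then show ?thesis using edges(3)[OF a] edges(1)[OF b] 6 by (auto simp: field_simps)
  next
    case 7
    then have "y - x/2 = - n" using V(3,6) by (simp; argo)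
    then show ?thesis using edges(4)[OF a] edges(2)[OF b] 7 by (auto simp: field_simps)
  qed simp
qed

section \<open>Polygons in the complex plane\<close>

lemma (in linorder) sorted_key_list_of_set_eqI:
  assumes "sorted_wrt (<) (map f l)"
  shows "sorted_key_list_of_set f (set l) = l"
proof -
  have "distinct (map f l)" "sorted (map f l)"
    using assms by (simp_all add: strict_sorted_iff)
  then interpret folding_insort_key "(\<le>)" "(<)" "set l" f
    by unfold_locales (simp add: distinct_map)
  show ?thesis
    using \<open>distinct (map f l)\<close> \<open>sorted (map f l)\<close> by (intro idem_if_sorted_distinct) (auto simp: distinct_map)
qed

text \<open>In the reverse order \<open>a / b\<close> would have an angle below pi, against the sign
  of its imaginary part. Angles are thus compared without computing them.\<close>

lemma Arg2pi_less_upper_half: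
  assumes "Im a > 0" "Im b > 0" "Im (b / a) > 0"
  shows "Arg2pi a < Arg2pi b"
proof (rule ccontr)
  assume "\<not> Arg2pi a < Arg2pi b"
  then have "Arg2pi b \<le> Arg2pi a" by simp
  then have "Arg2pi (a / b) = Arg2pi a - Arg2pi b"
    using assms by (intro Arg2pi_divide) auto
  also have "\<dots> < pi"
    using Arg2pi_lt_pi[of a] Arg2pi_lt_pi[of b] assms by linarith
  finally have "0 \<le> Im (a / b)"
    using Arg2pi_le_pi[of "a / b"] by simp
  with assms(3) show False
    by (simp add: Im_complex_div_ge_0 Im_complex_div_gt_0 algebra_simps)
qed

text \<open>Negation adds pi to an angle below pi, so for a centrally symmetric polygon only half of
  the vertices has to be sorted.\<close>

lemma sorted_wrt_Arg2pi_symmetric: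
  assumes "sorted_wrt (<) (map (\<lambda>v. Arg2pi (v / s)) vs)"
    and "\<And>v. v \<in> set vs \<Longrightarrow> v / s \<noteq> 0 \<and> Arg2pi (v / s) < pi"
  shows "sorted_wrt (<) (map (\<lambda>v. Arg2pi (v / s)) (vs @ map uminus vs))"
proof -
  have neg: "Arg2pi (- (v / s)) = Arg2pi (v / s) + pi" if "v \<in> set vs" for v
    using assms(2)[OF that] Arg2pi_minus[of "v / s"] by simp
  have "map (\<lambda>v. Arg2pi (v / s)) (map uminus vs) = map (\<lambda>v. Arg2pi (v / s) + pi) vs"
    using neg by simp
  moreover have "sorted_wrt (<) (map (\<lambda>v. Arg2pi (v / s) + pi) vs)"
    using assms(1) by (simp add: sorted_wrt_map)
  moreover have "Arg2pi (v / s) < Arg2pi (u / s) + pi" if "v \<in> set vs" "u \<in> set vs" for u v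
    using assms(2)[OF that(1)] Arg2pi_ge_0[of "u / s"] by linarith
  ultimately show ?thesis
    using assms(1) neg unfolding map_append sorted_wrt_append by (auto simp: o_def cong: map_cong)
qed

lemma vertex_list_eqI:
  assumes "voronoi_vertices \<tau> = set vs"
    and "sorted_wrt (<) (map (\<lambda>v. Arg2pi (v / start_vertex \<tau>)) vs)"
  shows "vertex_list \<tau> = vs" "num_vertices \<tau> = length vs"
proof -
  show "vertex_list \<tau> = vs"
    unfolding vertex_list_def assms(1) by (rule sorted_key_list_of_set_eqI[OF assms(2)])
  have "distinct vs"
    using assms(2) by (auto simp: strict_sorted_iff distinct_map)
  then show "num_vertices \<tau> = length vs"
    by (simp add: num_vertices_def assms(1) distinct_card)
qed

lemma not_extreme_point_of_if_midpoint:
  fixes d :: "'a::euclidean_space"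
  assumes "z + d \<in> S" "z - d \<in> S" "d \<noteq> 0"
  shows "\<not> z extreme_point_of S"
proof -
  have "midpoint (z + d) (z - d) = z"
    by (simp add: midpoint_def flip: scaleR_2)
  moreover have "z + d \<noteq> z - d"
  proof
    assume "z + d = z - d"
    then have "2 *\<^sub>R d = 0" by (simp add: scaleR_2 algebra_simps)
    with assms(3) show False by simp
  qed
  ultimately have "z \<in> open_segment (z + d) (z - d)"
    by (metis midpoint_in_open_segment)
  with assms show ?thesis
    unfolding extreme_point_of_def by blast
qed

lemma abs_add_le:
  fixes a b c :: "'a::linordered_idom"
  assumes "\<bar>a\<bar> + \<bar>b\<bar> \<le> c"
  shows "\<bar>a + b\<bar> \<le> c" "\<bar>a - b\<bar> \<le> c"
  using assms abs_triangle_ineq[of a b] abs_triangle_ineq4[of a b] by linarith+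

text \<open>The gaps c - x and c - y are nonnegative and their weighted sum vanishes; the other end
  of the interval follows by negation.\<close>

lemma eq_if_convex_combination_tight:
  fixes u x y c :: real
  assumes "0 < u" "u < 1" "\<bar>x\<bar> \<le> c" "\<bar>y\<bar> \<le> c" "\<bar>(1 - u) * x + u * y\<bar> = c"
  shows "x = y"
proof -
  have "x = y" if "x \<le> c" "y \<le> c" "(1 - u) * x + u * y = c" for x y
  proof -
    have "(1 - u) * (c - x) + u * (c - y) = 0"
      using that(3) by (simp add: algebra_simps)
    moreover have "0 \<le> (1 - u) * (c - x)" "0 \<le> u * (c - y)"
      using assms that by auto
    ultimately have "(1 - u) * (c - x) = 0" "u * (c - y) = 0"
      by linarith+
    then show ?thesis using assms(1,2) by simp
  qed
  from this[of x y] this[of "-x" "-y"] show ?thesis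
    using assms(3-5) by (auto simp: abs_if algebra_simps split: if_splits)
qed

text \<open>A segment through \<open>z\<close> inside both strips is constant under both
  functionals, and these separate points because their determinant is nonzero.\<close>

lemma extreme_point_of_stripsI:
  fixes z :: complex
  assumes "z \<in> S"
    and "\<And>x. x \<in> S \<Longrightarrow> \<bar>e \<bullet> x\<bar> \<le> \<bar>e \<bullet> z\<bar>" "\<And>x. x \<in> S \<Longrightarrow> \<bar>f \<bullet> x\<bar> \<le> \<bar>f \<bullet> z\<bar>"
    and "Re e * Im f \<noteq> Im e * Re f"
  shows "z extreme_point_of S"
proof -
  have "z \<notin> open_segment a b" if "a \<in> S" "b \<in> S" for a b
  proof
    assume "z \<in> open_segment a b"
    then obtain u where u: "0 < u" "u < 1" "z = (1 - u) *\<^sub>R a + u *\<^sub>R b" and "a \<noteq> b"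
      by (auto simp: in_segment)
    have "e \<bullet> z = (1 - u) * (e \<bullet> a) + u * (e \<bullet> b)" "f \<bullet> z = (1 - u) * (f \<bullet> a) + u * (f \<bullet> b)"
      by (simp_all add: u(3) inner_add_right)
    then have "e \<bullet> a = e \<bullet> b" "f \<bullet> a = f \<bullet> b"
      using that u(1,2) assms(2,3) by (metis eq_if_convex_combination_tight)+
    then have "Re e * (Re a - Re b) + Im e * (Im a - Im b) = 0"
      "Re f * (Re a - Re b) + Im f * (Im a - Im b) = 0"
      by (simp_all add: inner_complex_def algebra_simps)
    then have "(Re e * Im f - Im e * Re f) * (Re a - Re b) = 0"
      "(Re e * Im f - Im e * Re f) * (Im a - Im b) = 0"
      by algebra+
    with assms(4) \<open>a \<noteq> b\<close> show False by (simp add: complex_eq_iff)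
  qed
  with assms(1) show ?thesis
    by (auto simp: extreme_point_of_def)
qed

text \<open>The factor \<open>h\<close> puts the line equation in the coordinate
  \<open>h * Im z\<close>, in which the corners of the hexagon are affine in
  \<open>n\<close>.\<close>

lemma complex_open_segment_iff:
  assumes "Re a \<noteq> Re b" "h \<noteq> 0"
  shows "z \<in> open_segment a b \<longleftrightarrow>
    (Re a < Re z \<and> Re z < Re b \<or> Re b < Re z \<and> Re z < Re a) \<and>
    (h * Im z - h * Im a) * (Re b - Re a) = (h * Im b - h * Im a) * (Re z - Re a)"
    (is "_ \<longleftrightarrow> ?R")
proof
  assume "z \<in> open_segment a b"
  then obtain u where u: "0 < u" "u < 1" "z = (1 - u) *\<^sub>R a + u *\<^sub>R b"
    by (auto simp: in_segment)
  then have z: "Re z - Re a = u * (Re b - Re a)" "Re b - Re z = (1 - u) * (Re b - Re a)"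
    "Im z - Im a = u * (Im b - Im a)"
    by (simp_all add: left_diff_distrib right_diff_distrib)
  have "Re a < Re z \<and> Re z < Re b" if "Re a < Re b"
  proof -
    have "0 < u * (Re b - Re a)" "0 < (1 - u) * (Re b - Re a)"
      using u(1,2) that by simp_all
    then show ?thesis using z by linarith
  qed
  moreover have "Re b < Re z \<and> Re z < Re a" if "Re b < Re a"
  proof -
    have "u * (Re b - Re a) < 0" "(1 - u) * (Re b - Re a) < 0"
      using u(1,2) that by (simp_all add: mult_less_0_iff)
    then show ?thesis using z by linarith
  qed
  moreover have "(h * Im z - h * Im a) * (Re b - Re a) = (h * Im b - h * Im a) * (Re z - Re a)"
    unfolding z(1) right_diff_distrib[symmetric] z(3) by simp
  ultimately show ?R
    using assms by linarith
next
  assume R: ?R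
  define u where "u = (Re z - Re a) / (Re b - Re a)"
  have "0 < u" "u < 1"
    using R assms by (auto simp: u_def divide_simps)
  moreover have "Re z = (1 - u) * Re a + u * Re b"
  proof -
    have "u * (Re b - Re a) = Re z - Re a"
      using assms by (simp add: u_def)
    then show ?thesis by (simp add: algebra_simps)
  qed
  moreover have "(Im z - Im a) * (Re b - Re a) = (Im b - Im a) * (Re z - Re a)"
    using R assms(2) by (simp flip: right_diff_distrib)
  then have "Im z - Im a = u * (Im b - Im a)"
    using assms by (simp add: u_def field_simps)
  then have "Im z = (1 - u) * Im a + u * Im b"
    by (simp add: algebra_simps)
  ultimately show "z \<in> open_segment a b"
    using assms by (auto simp: in_segment intro!: exI[of _ u] complex_eqI)
qed

lemma complex_open_segment_vertical_iff:
  assumes "Re a = Re b" "Im a \<noteq> Im b"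
  shows "z \<in> open_segment a b \<longleftrightarrow>
    Re z = Re a \<and> (Im a < Im z \<and> Im z < Im b \<or> Im b < Im z \<and> Im z < Im a)"
proof -
  \<comment> \<open>A quarter turn reduces vertical segments to the non-vertical case.\<close>
  have mul: "\<i> * x \<in> open_segment (\<i> * a) (\<i> * b) \<longleftrightarrow> x \<in> open_segment a b" for x
    using open_segment_linear_image[of "(*) \<i>" a b]
    by (auto simp: bounded_linear.linear[OF bounded_linear_mult_right] inj_def)
  show ?thesis
    unfolding mul[of z, symmetric]
    using complex_open_segment_iff[of "\<i> * a" "\<i> * b" 1 "\<i> * z"] assms by auto
qed

section \<open>The Voronoi conditions as half-planes, and reduction to finitely many of them\<close>

lemma cmod_le_cmod_diff_iff: "cmod z \<le> cmod (z - y) \<longleftrightarrow> 2 * (z \<bullet> y) \<le> y \<bullet> y"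
  by (simp add: norm_le inner_diff_left inner_diff_right inner_commute)

lemma in_voronoi_iff: "z \<in> voronoi \<tau> \<longleftrightarrow> (\<forall>y\<in>Z_adjoin \<tau>. 2 * (z \<bullet> y) \<le> y \<bullet> y)"
  by (simp add: voronoi_def cmod_le_cmod_diff_iff)

lemma interior_strip:
  fixes e :: "'a::euclidean_space"
  assumes "e \<noteq> 0"
  shows "interior {z. \<bar>e \<bullet> z\<bar> \<le> c} = {z. \<bar>e \<bullet> z\<bar> < c}"
proof -
  have "{z. \<bar>e \<bullet> z\<bar> \<le> c} = {z. e \<bullet> z \<le> c} \<inter> {z. e \<bullet> z \<ge> - c}"
    by auto
  then show ?thesis
    using assms by auto
qed

lemma abs_int_le_square: "\<bar>real_of_int k\<bar> \<le> real_of_int k * real_of_int k"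
  using self_le_power[of "\<bar>k\<bar>" 2]
  by (cases "k = 0") (auto simp: power2_eq_square simp flip: of_int_abs of_int_mult)

text \<open>The half-plane conditions of a lattice vector and its negative imply those of all its
  integer multiples, since |k| is at most k^2.\<close>

lemma twice_mult_int_le:
  fixes x c :: real
  assumes "2 * \<bar>x\<bar> \<le> c"
  shows "2 * (of_int k * x) \<le> c * (of_int k * of_int k)"
proof -
  have "2 * (of_int k * x) \<le> 2 * (\<bar>of_int k\<bar> * \<bar>x\<bar>)"
    using abs_ge_self[of "of_int k * x"] by (simp add: abs_mult)
  also have "\<dots> = \<bar>of_int k\<bar> * (2 * \<bar>x\<bar>)" by simp
  also have "\<dots> \<le> (of_int k * of_int k) * c"
    using assms abs_int_le_square by (intro mult_mono) auto
  finally show ?thesis by (simp add: mult.commute)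
qed

section \<open>The restricted Voronoi cell of a rectangular lattice\<close>

locale rectangular_lattice =
  fixes \<tau> :: complex and h :: real
  assumes h_pos: "h > 0"
    and lattice: "z \<in> Z_adjoin \<tau> \<longleftrightarrow> (\<exists>i j :: int. z = Complex (of_int i) (of_int j * h))"
begin

text \<open>The basis is orthogonal, so the condition for (i, j) is the sum of one for i and one for
  j.\<close>

lemma in_voronoi: "z \<in> voronoi \<tau> \<longleftrightarrow> \<bar>Re z\<bar> \<le> 1/2 \<and> \<bar>Im z\<bar> \<le> h/2"
proof
  assume z: "z \<in> voronoi \<tau>"
  have y: "2 * (z \<bullet> y) \<le> y \<bullet> y" if "y = Complex (of_int i) (of_int j * h)" for y i j
    using z that lattice by (auto simp: in_voronoi_iff)
  have "2 * Im z * h \<le> h * h" "- 2 * Im z * h \<le> h * h"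
    using y[OF refl, of 0 1] y[OF refl, of 0 "-1"] by (auto simp: inner_complex_def)
  then have "2 * Im z \<le> h" "- 2 * Im z \<le> h"
    using h_pos mult_right_le_imp_le by blast+
  then show "\<bar>Re z\<bar> \<le> 1/2 \<and> \<bar>Im z\<bar> \<le> h/2"
    using y[OF refl, of 1 0] y[OF refl, of "-1" 0] by (auto simp: inner_complex_def)
next
  assume z: "\<bar>Re z\<bar> \<le> 1/2 \<and> \<bar>Im z\<bar> \<le> h/2"
  have "2 * (Re z * of_int i + Im z * (of_int j * h)) \<le> of_int i * of_int i + of_int j * h * (of_int j * h)"
    for i j :: int
  proof -
    have "2 * (of_int i * Re z) \<le> 1 * (of_int i * of_int i)"
      using z by (intro twice_mult_int_le) simp
    moreover have "2 * (of_int j * Im z) \<le> h * (of_int j * of_int j)"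
      using z by (intro twice_mult_int_le) simp
    then have "2 * (of_int j * Im z) * h \<le> h * (of_int j * of_int j) * h"
      using h_pos by (intro mult_right_mono) auto
    ultimately show ?thesis by (simp add: algebra_simps)
  qed
  then show "z \<in> voronoi \<tau>"
    using lattice by (auto simp: in_voronoi_iff inner_complex_def)
qed

lemma not_extreme_point:
  assumes "\<bar>Re z\<bar> + \<bar>\<alpha>\<bar> \<le> 1/2" "\<bar>Im z\<bar> + \<bar>\<beta>\<bar> \<le> h/2" "\<alpha> \<noteq> 0 \<or> \<beta> \<noteq> 0"
  shows "\<not> z extreme_point_of voronoi \<tau>"
proof (rule not_extreme_point_of_if_midpoint)
  show "z + Complex \<alpha> \<beta> \<in> voronoi \<tau>" "z - Complex \<alpha> \<beta> \<in> voronoi \<tau>"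
    using abs_add_le[OF assms(1)] abs_add_le[OF assms(2)] by (simp_all add: in_voronoi)
  show "Complex \<alpha> \<beta> \<noteq> 0"
    using assms(3) by (auto simp: complex_eq_iff)
qed

lemma voronoi_vertices_eq:
  "voronoi_vertices \<tau> =
     set [Complex (1/2) (h/2), Complex (-1/2) (h/2), Complex (-1/2) (-h/2), Complex (1/2) (-h/2)]"
  (is "_ = set ?vs")
proof (rule set_eqI, rule iffI)
  fix z assume "z \<in> voronoi_vertices \<tau>"
  then have z: "z extreme_point_of voronoi \<tau>" by (simp add: voronoi_vertices_def)
  then have zV: "\<bar>Re z\<bar> \<le> 1/2" "\<bar>Im z\<bar> \<le> h/2"
    by (auto simp: extreme_point_of_def in_voronoi)
  \<comment> \<open>Positive slack in one strip would allow a move by that slack in both directions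
    along its axis.\<close>
  have "\<bar>Re z\<bar> = 1/2"
    using not_extreme_point[of z "1/2 - \<bar>Re z\<bar>" 0] z zV by force
  moreover have "\<bar>Im z\<bar> = h/2"
    using not_extreme_point[of z 0 "h/2 - \<bar>Im z\<bar>"] z zV by force
  ultimately have "Re z = 1/2 \<or> Re z = -1/2" "Im z = h/2 \<or> Im z = -h/2"
    by argo+
  then show "z \<in> set ?vs"
    by (auto simp: complex_eq_iff)
next
  fix z assume z: "z \<in> set ?vs"
  then have "\<bar>Re z\<bar> = 1/2" "\<bar>Im z\<bar> = h/2" using h_pos by auto
  then show "z \<in> voronoi_vertices \<tau>"
    unfolding voronoi_vertices_def
    by (auto intro!: extreme_point_of_stripsI[where e = 1 and f = \<i>] simp: in_voronoi)
qed

lemma start_vertex_eq: "start_vertex \<tau> = Complex (1/2) (h/2)"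
  unfolding start_vertex_def voronoi_vertices_eq using h_pos by (intro the_equality) auto

lemma vertex_list:
  "vertex_list \<tau> =
     [Complex (1/2) (h/2), Complex (-1/2) (h/2), Complex (-1/2) (-h/2), Complex (1/2) (-h/2)]"
  (is "_ = ?vs")
  and num_vertices: "num_vertices \<tau> = 4"
proof -
  define v where "v = Complex (-1/2) (h/2)"
  define s where "s = start_vertex \<tau>"
  have "s \<noteq> 0" "Im (v / s) > 0"
    using h_pos by (auto simp: v_def s_def start_vertex_eq Im_complex_div_gt_0 complex_eq_iff)
  then have "sorted_wrt (<) (map (\<lambda>v. Arg2pi (v / s)) ([s, v] @ map uminus [s, v]))"
    using Arg2pi_lt_pi[of "v / s"] Arg2pi_real[of 1] by (intro sorted_wrt_Arg2pi_symmetric) auto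
  moreover have "[s, v] @ map uminus [s, v] = ?vs"
    by (simp add: s_def start_vertex_eq v_def complex_eq_iff)
  ultimately have *: "sorted_wrt (<) (map (\<lambda>v. Arg2pi (v / start_vertex \<tau>)) ?vs)"
    unfolding s_def by (simp only:)
  show "vertex_list \<tau> = ?vs" "num_vertices \<tau> = 4"
    using vertex_list_eqI[OF voronoi_vertices_eq *] by simp_all
qed

lemma interior_voronoi: "interior (voronoi \<tau>) = {z. \<bar>Re z\<bar> < 1/2 \<and> \<bar>Im z\<bar> < h/2}"
proof -
  have "voronoi \<tau> = {z. \<bar>1 \<bullet> z\<bar> \<le> 1/2} \<inter> {z. \<bar>\<i> \<bullet> z\<bar> \<le> h/2}"
    by (auto simp: in_voronoi)
  then have "interior (voronoi \<tau>) = interior {z. \<bar>1 \<bullet> z\<bar> \<le> 1/2} \<inter> interior {z. \<bar>\<i> \<bullet> z\<bar> \<le> h/2}"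
    by (simp only: interior_Int)
  then show ?thesis
    unfolding interior_strip[OF one_neq_zero] interior_strip[OF complex_i_not_zero]
    by auto
qed

text \<open>With four vertices, \<open>4 div 2 = 2\<close> admits the midpoints of the top and left
  edges and \<open>4 div 3 = 1\<close> the corner v_1; the last edge wraps around to
  \<open>vertex \<tau> 4\<close>, which is v_0.\<close>

lemma in_restricted_voronoi: "z \<in> restricted_voronoi \<tau> \<longleftrightarrow> rect_cell h (Re z) (Im z)"
proof -
  have v: "vertex \<tau> 0 = Complex (1/2) (h/2)" "vertex \<tau> 1 = Complex (-1/2) (h/2)"
    "vertex \<tau> 2 = Complex (-1/2) (-h/2)" "vertex \<tau> 3 = Complex (1/2) (-h/2)"
    "vertex \<tau> 4 = Complex (1/2) (h/2)"
    by (simp_all add: vertex_def vertex_list num_vertices)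
  have m: "edge_midpoint \<tau> 0 = Complex 0 (h/2)" "edge_midpoint \<tau> 1 = Complex (-1/2) 0"
    "edge_midpoint \<tau> 2 = Complex 0 (-h/2)" "edge_midpoint \<tau> 3 = Complex (1/2) 0"
    by (simp_all add: edge_midpoint_def v midpoint_def complex_eq_iff flip: One_nat_def)
  have k: "{..<4::nat} = {0,1,2,3}" "{k. k < (2::nat)} = {0,1}" "{1..1::nat} = {1}"
    by auto
  have cell: "restricted_voronoi \<tau> = {z. \<bar>Re z\<bar> < 1/2 \<and> \<bar>Im z\<bar> < h/2} \<union>
    (open_segment (Complex 0 (h/2)) (Complex (-1/2) (h/2)) \<union>
     open_segment (Complex (-1/2) 0) (Complex (-1/2) (-h/2)) \<union>
     open_segment (Complex 0 (-h/2)) (Complex (1/2) (-h/2)) \<union>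
     open_segment (Complex (1/2) 0) (Complex (1/2) (h/2))) \<union>
    {Complex 0 (h/2), Complex (-1/2) 0} \<union> {Complex (-1/2) (h/2)}"
    unfolding restricted_voronoi_def num_vertices interior_voronoi
    by (simp add: k m v Un_assoc flip: One_nat_def)
  have seg_horizontal:
    "z \<in> open_segment (Complex 0 (h/2)) (Complex (-1/2) (h/2)) \<longleftrightarrow> -1/2 < Re z \<and> Re z < 0 \<and> Im z = h/2"
    "z \<in> open_segment (Complex 0 (-h/2)) (Complex (1/2) (-h/2)) \<longleftrightarrow> 0 < Re z \<and> Re z < 1/2 \<and> Im z = -h/2"
    by (auto simp: complex_open_segment_iff[where h = 1])
  have seg_vertical:
    "z \<in> open_segment (Complex (-1/2) 0) (Complex (-1/2) (-h/2)) \<longleftrightarrow> Re z = -1/2 \<and> -h/2 < Im z \<and> Im z < 0"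
    "z \<in> open_segment (Complex (1/2) 0) (Complex (1/2) (h/2)) \<longleftrightarrow> Re z = 1/2 \<and> 0 < Im z \<and> Im z < h/2"
    using h_pos by (auto simp: complex_open_segment_vertical_iff)
  have edges:
    "Im z = h/2 \<and> -1/2 \<le> Re z \<and> Re z \<le> 0 \<longleftrightarrow>
       -1/2 < Re z \<and> Re z < 0 \<and> Im z = h/2 \<or> z = Complex 0 (h/2) \<or> z = Complex (-1/2) (h/2)"
    "Re z = -1/2 \<and> -h/2 < Im z \<and> Im z \<le> 0 \<longleftrightarrow>
       Re z = -1/2 \<and> -h/2 < Im z \<and> Im z < 0 \<or> z = Complex (-1/2) 0"
    using h_pos by (auto simp: complex_eq_iff)
  show ?thesis
    unfolding rect_cell_def cell edges
    by (simp only: Un_iff mem_Collect_eq insert_iff empty_iff seg_horizontal seg_vertical disj_ac conj_ac simp_thms)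
qed

lemma restricted_voronoi_subset: "restricted_voronoi \<tau> \<subseteq> voronoi \<tau>"
  using rect_cell_bounds[OF h_pos] by (auto simp: in_restricted_voronoi in_voronoi)

lemma restricted_voronoi_covers:
  assumes "z \<in> voronoi \<tau>"
  shows "\<exists>u\<in>Z_adjoin \<tau>. z - u \<in> restricted_voronoi \<tau>"
proof -
  obtain i j :: int where "rect_cell h (Re z - of_int i) (Im z - of_int j * h)"
    using rect_cell_covers[OF h_pos] assms in_voronoi by blast
  then have "z - Complex (of_int i) (of_int j * h) \<in> restricted_voronoi \<tau>"
    by (simp add: in_restricted_voronoi)
  then show ?thesis using lattice by blast
qed

lemma restricted_voronoi_disjoint:
  assumes "z \<in> restricted_voronoi \<tau>" "z - u \<in> restricted_voronoi \<tau>" "u \<in> Z_adjoin \<tau>"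
  shows "u = 0"
proof -
  obtain i j :: int where u: "u = Complex (of_int i) (of_int j * h)"
    using assms(3) lattice by blast
  then have "i = 0 \<and> j = 0"
    using assms(1,2) rect_cell_disjoint[OF h_pos] by (simp add: in_restricted_voronoi)
  then show ?thesis by (simp add: u complex_eq_iff)
qed

end

section \<open>The restricted Voronoi cell of a hexagonal lattice\<close>

text \<open>The bound on \<open>h\<close> says that \<omega> = 1/2 + h i has modulus at least 1. In
  particular n > 1/4, so the vertical edges have positive length and the cell has six
  vertices.\<close>

locale hexagonal_lattice =
  fixes \<tau> :: complex and h :: real
  assumes h_pos: "h > 0" and h_sq: "h\<^sup>2 \<ge> 3/4"
    and lattice: "z \<in> Z_adjoin \<tau> \<longleftrightarrow>
      (\<exists>i j :: int. z = Complex (of_int i + of_int j / 2) (of_int j * h))"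
begin

definition n :: real where "n = h\<^sup>2 / 2 + 1/8"

lemma n_ge: "n \<ge> 1/2"
  using h_sq by (simp add: n_def)

lemma h_h: "h * h = 2 * n - 1/4"
  by (simp add: n_def power2_eq_square)

text \<open>The conditions come from 1, \<omega>, \<omega> - 1 and their negatives. Any other
  lattice vector is a combination of two of these three whose cross term in the norm form is
  nonnegative; the sign cases below choose the pair.\<close>

lemma in_voronoi:
  "z \<in> voronoi \<tau> \<longleftrightarrow> \<bar>Re z\<bar> \<le> 1/2 \<and> \<bar>Re z / 2 + h * Im z\<bar> \<le> n \<and> \<bar>Re z / 2 - h * Im z\<bar> \<le> n"
proof
  assume z: "z \<in> voronoi \<tau>"
  have y: "2 * (z \<bullet> y) \<le> y \<bullet> y" if "y = Complex (of_int i + of_int j / 2) (of_int j * h)" for y i j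
    using z that lattice unfolding in_voronoi_iff by blast
  show "\<bar>Re z\<bar> \<le> 1/2 \<and> \<bar>Re z / 2 + h * Im z\<bar> \<le> n \<and> \<bar>Re z / 2 - h * Im z\<bar> \<le> n"
    using y[OF refl, of 1 0] y[OF refl, of "-1" 0] y[OF refl, of 0 1] y[OF refl, of 0 "-1"]
      y[OF refl, of 1 "-1"] y[OF refl, of "-1" 1]
    by (auto simp: inner_complex_def h_h algebra_simps)
next
  assume z: "\<bar>Re z\<bar> \<le> 1/2 \<and> \<bar>Re z / 2 + h * Im z\<bar> \<le> n \<and> \<bar>Re z / 2 - h * Im z\<bar> \<le> n"
  have "2 * (Re z * (of_int i + of_int j / 2) + Im z * (of_int j * h))
    \<le> (of_int i + of_int j / 2) * (of_int i + of_int j / 2) + of_int j * h * (of_int j * h)"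
    for i j :: int
  proof -
    define x b c where "x = Re z" and "b = Re z / 2 + h * Im z" and "c = h * Im z - Re z / 2"
    have xbc: "2 * \<bar>x\<bar> \<le> 1" "2 * \<bar>b\<bar> \<le> 2 * n" "2 * \<bar>c\<bar> \<le> 2 * n" "b = x + c"
      using z by (auto simp: x_def b_def c_def)
    define I J where "I = real_of_int i" and "J = real_of_int j"
    have lhs: "Re z * (I + J / 2) + Im z * (J * h) = I * x + J * b"
      by (simp add: x_def b_def algebra_simps)
    have rhs: "(I + J / 2) * (I + J / 2) + J * h * (J * h) = I * I + I * J + J * J * (2 * n)"
    proof -
      have "J * h * (J * h) = J * J * (h * h)" by (simp add: algebra_simps)
      then show ?thesis unfolding h_h by (simp add: field_simps)
    qed
    \<comment> \<open>Here x, b, c are the inner products of z with 1, \<omega>, \<omega> - 1. The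
      cases use the pairs (1, \<omega>), (1, \<omega> - 1) and (\<omega>, \<omega> - 1), with
      coefficients (I, J), (I + J, J) and (I + J, -I).\<close>
    have "2 * (I * x + J * b) \<le> I * I + I * J + J * J * (2 * n)"
    proof (cases "I * J \<ge> 0")
      case True
      then show ?thesis
        using twice_mult_int_le[OF xbc(1), of i] twice_mult_int_le[OF xbc(2), of j]
        by (simp add: I_def J_def algebra_simps)
    next
      case IJ: False
      show ?thesis
      proof (cases "(I + J) * J \<le> 0")
        case True
        then show ?thesis
          using twice_mult_int_le[OF xbc(1), of "i + j"] twice_mult_int_le[OF xbc(3), of j]
          unfolding xbc(4) by (simp add: I_def J_def algebra_simps)
      next
        case False
        have IK: "I * (I + J) \<le> 0"
          using IJ False by (auto simp: not_le not_less mult_less_0_iff zero_less_mult_iff mult_le_0_iff)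
        \<comment> \<open>4 * n - 1 is twice the inner product of \<omega> and \<omega> - 1.\<close>
        have "I * (I + J) * (4 * n - 1) \<le> 0"
          using mult_nonpos_nonneg[OF IK, of "4 * n - 1"] n_ge by simp
        moreover have "2 * (- I * c) \<le> 2 * n * (I * I)"
          using twice_mult_int_le[OF xbc(3), of "- i"] by (simp add: I_def)
        moreover have "2 * ((I + J) * b) \<le> 2 * n * ((I + J) * (I + J))"
          using twice_mult_int_le[OF xbc(2), of "i + j"] by (simp add: I_def J_def)
        ultimately show ?thesis
          unfolding xbc(4) by (simp add: algebra_simps)
      qed
    qed
    then show ?thesis
      using lhs rhs by (simp add: I_def J_def)
  qed
  then show "z \<in> voronoi \<tau>"
    using lattice by (auto simp: in_voronoi_iff inner_complex_def)
qed

text \<open>The displacement is (\<alpha>, \<beta>) in the coordinates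
  \<open>(Re z, h * Im z)\<close>, hence the division by \<open>h\<close>.\<close>

lemma not_extreme_point:
  assumes "\<bar>Re z\<bar> + \<bar>\<alpha>\<bar> \<le> 1/2" "\<bar>Re z / 2 + h * Im z\<bar> + \<bar>\<alpha> / 2 + \<beta>\<bar> \<le> n"
    "\<bar>Re z / 2 - h * Im z\<bar> + \<bar>\<alpha> / 2 - \<beta>\<bar> \<le> n" "\<alpha> \<noteq> 0 \<or> \<beta> \<noteq> 0"
  shows "\<not> z extreme_point_of voronoi \<tau>"
proof (rule not_extreme_point_of_if_midpoint)
  show "z + Complex \<alpha> (\<beta> / h) \<in> voronoi \<tau>" "z - Complex \<alpha> (\<beta> / h) \<in> voronoi \<tau>"
    using h_pos abs_add_le[OF assms(1)] abs_add_le[OF assms(2)] abs_add_le[OF assms(3)]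
    by (simp_all add: in_voronoi algebra_simps add_divide_distrib diff_divide_distrib)
  show "Complex \<alpha> (\<beta> / h) \<noteq> 0"
    using assms(4) h_pos by (auto simp: complex_eq_iff)
qed

lemma voronoi_vertices_eq:
  "voronoi_vertices \<tau> =
     set [Complex (1/2) ((n - 1/4) / h), Complex 0 (n / h), Complex (-1/2) ((n - 1/4) / h),
          Complex (-1/2) (- ((n - 1/4) / h)), Complex 0 (- (n / h)), Complex (1/2) (- ((n - 1/4) / h))]"
  (is "_ = set ?vs")
proof (rule set_eqI, rule iffI)
  fix z assume "z \<in> voronoi_vertices \<tau>"
  then have z: "z extreme_point_of voronoi \<tau>" by (simp add: voronoi_vertices_def)
  define x b c where "x = Re z" and "b = Re z / 2 + h * Im z" and "c = Re z / 2 - h * Im z"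
  have V: "\<bar>x\<bar> \<le> 1/2" "\<bar>b\<bar> \<le> n" "\<bar>c\<bar> \<le> n" "x = b + c"
    using z by (auto simp: extreme_point_of_def in_voronoi x_def b_def c_def)
  have no: False if "\<bar>x\<bar> + \<bar>\<alpha>\<bar> \<le> 1/2" "\<bar>b\<bar> + \<bar>\<alpha> / 2 + \<beta>\<bar> \<le> n" "\<bar>c\<bar> + \<bar>\<alpha> / 2 - \<beta>\<bar> \<le> n" "\<alpha> \<noteq> 0 \<or> \<beta> \<noteq> 0" for \<alpha> \<beta>
    using not_extreme_point[of z \<alpha> \<beta>] that z by (simp add: x_def b_def c_def)
  \<comment> \<open>Each of the three displacements is parallel to the edges of the third strip and
    as long as the smaller slack of the other two allows. Hence at most one constraint is slack, and
    two are tight.\<close>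
  have xb: "\<bar>x\<bar> = 1/2 \<or> \<bar>b\<bar> = n"
    using V no[of "min (1/2 - \<bar>x\<bar>) (n - \<bar>b\<bar>)" "min (1/2 - \<bar>x\<bar>) (n - \<bar>b\<bar>) / 2"] by argo
  have xc: "\<bar>x\<bar> = 1/2 \<or> \<bar>c\<bar> = n"
    using V no[of "min (1/2 - \<bar>x\<bar>) (n - \<bar>c\<bar>)" "- min (1/2 - \<bar>x\<bar>) (n - \<bar>c\<bar>) / 2"] by argo
  have bc: "\<bar>b\<bar> = n \<or> \<bar>c\<bar> = n"
    using V no[of 0 "min (n - \<bar>b\<bar>) (n - \<bar>c\<bar>)"] by argo
  have Im_iff: "Im z = y \<longleftrightarrow> b - x/2 = h * y" for y
    using h_pos by (simp add: b_def x_def)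
  consider "x = 1/2" "b = n" | "x = 1/2" "b = 1/2 - n" | "x = -1/2" "b = -n" | "x = -1/2" "b = n - 1/2"
    | "x = 0" "b = n" | "x = 0" "b = -n"
    using xb xc bc V n_ge by argo
  then show "z \<in> set ?vs"
    by cases (use h_pos in \<open>simp_all add: complex_eq_iff Im_iff flip: x_def\<close>)
next
  fix z assume z: "z \<in> set ?vs"
  then have zV: "z \<in> voronoi \<tau>" using h_pos n_ge by (auto simp: in_voronoi)
  have ex: "z extreme_point_of voronoi \<tau>"
    if "Re e * Im f \<noteq> Im e * Re f"
      "\<bar>e \<bullet> z\<bar> = ce" "\<bar>f \<bullet> z\<bar> = cf" "\<And>x. x \<in> voronoi \<tau> \<Longrightarrow> \<bar>e \<bullet> x\<bar> \<le> ce \<and> \<bar>f \<bullet> x\<bar> \<le> cf" for e f ce cf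
    using that zV by (intro extreme_point_of_stripsI[where e = e and f = f]) auto
  have "\<bar>Re z\<bar> = 1/2 \<and> \<bar>Re z / 2 + h * Im z\<bar> = n \<or> \<bar>Re z\<bar> = 1/2 \<and> \<bar>Re z / 2 - h * Im z\<bar> = n \<or>
    \<bar>Re z / 2 + h * Im z\<bar> = n \<and> \<bar>Re z / 2 - h * Im z\<bar> = n"
    using z h_pos n_ge by auto
  then have "z extreme_point_of voronoi \<tau>"
    using h_pos
    by (elim disjE; intro ex[of 1 "Complex (1/2) h" "1/2" n] ex[of 1 "Complex (1/2) (-h)" "1/2" n]
      ex[of "Complex (1/2) h" "Complex (1/2) (-h)" n n])
      (auto simp: in_voronoi inner_complex_def)
  then show "z \<in> voronoi_vertices \<tau>" by (simp add: voronoi_vertices_def)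
qed

lemma start_vertex_eq: "start_vertex \<tau> = Complex (1/2) ((n - 1/4) / h)"
  unfolding start_vertex_def voronoi_vertices_eq
  using h_pos n_ge by (intro the_equality) (auto simp: divide_less_0_iff zero_less_divide_iff)

lemma vertex_list:
  "vertex_list \<tau> =
     [Complex (1/2) ((n - 1/4) / h), Complex 0 (n / h), Complex (-1/2) ((n - 1/4) / h),
      Complex (-1/2) (- ((n - 1/4) / h)), Complex 0 (- (n / h)), Complex (1/2) (- ((n - 1/4) / h))]"
  (is "_ = ?vs")
  and num_vertices: "num_vertices \<tau> = 6"
proof -
  define u where "u = Complex 0 (n / h)"
  define v where "v = Complex (-1/2) ((n - 1/4) / h)"
  define s where "s = start_vertex \<tau>"
  have pos: "n / h > 0" "(n - 1/4) / h > 0" using h_pos n_ge by auto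
  \<comment> \<open>The signs say that s, u, v follow each other counter-clockwise within a
    half-turn; the remaining vertices are their negatives.\<close>
  have s0: "s \<noteq> 0" "Im (u / s) > 0" "Im (v / s) > 0" "Im (v / u) > 0"
    using pos by (auto simp: u_def v_def s_def start_vertex_eq Im_complex_div_gt_0 complex_eq_iff)
  then have "u \<noteq> 0" "v \<noteq> 0" by auto
  then have "Arg2pi (u / s) < Arg2pi (v / s)"
    using s0 by (intro Arg2pi_less_upper_half) auto
  then have "sorted_wrt (<) (map (\<lambda>v. Arg2pi (v / s)) ([s, u, v] @ map uminus [s, u, v]))"
    using s0 \<open>u \<noteq> 0\<close> \<open>v \<noteq> 0\<close> Arg2pi_lt_pi[of "v / s"] Arg2pi_lt_pi[of "u / s"] Arg2pi_real[of 1]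
    by (intro sorted_wrt_Arg2pi_symmetric) auto
  moreover have "[s, u, v] @ map uminus [s, u, v] = ?vs"
    by (simp add: s_def start_vertex_eq u_def v_def complex_eq_iff)
  ultimately have *: "sorted_wrt (<) (map (\<lambda>v. Arg2pi (v / start_vertex \<tau>)) ?vs)"
    unfolding s_def by (simp only:)
  show "vertex_list \<tau> = ?vs" "num_vertices \<tau> = 6"
    using vertex_list_eqI[OF voronoi_vertices_eq *] by simp_all
qed

lemma interior_voronoi:
  "interior (voronoi \<tau>) =
     {z. \<bar>Re z\<bar> < 1/2 \<and> \<bar>Re z / 2 + h * Im z\<bar> < n \<and> \<bar>Re z / 2 - h * Im z\<bar> < n}"
proof -
  have V: "voronoi \<tau> = {z. \<bar>1 \<bullet> z\<bar> \<le> 1/2} \<inter> {z. \<bar>Complex (1/2) h \<bullet> z\<bar> \<le> n} \<inter> {z. \<bar>Complex (1/2) (-h) \<bullet> z\<bar> \<le> n}"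
    by (auto simp: in_voronoi inner_complex_def)
  have ne: "Complex (1/2) h \<noteq> 0" "Complex (1/2) (-h) \<noteq> 0"
    by (auto simp: complex_eq_iff)
  have "interior (voronoi \<tau>) =
    {z. \<bar>1 \<bullet> z\<bar> < 1/2} \<inter> {z. \<bar>Complex (1/2) h \<bullet> z\<bar> < n} \<inter> {z. \<bar>Complex (1/2) (-h) \<bullet> z\<bar> < n}"
    unfolding V interior_Int interior_strip[OF one_neq_zero] interior_strip[OF ne(1)] interior_strip[OF ne(2)] ..
  then show ?thesis by (auto simp: inner_complex_def)
qed

lemma in_restricted_voronoi: "z \<in> restricted_voronoi \<tau> \<longleftrightarrow> hex_cell n (Re z) (h * Im z)"
proof -
  define s t where "s = n / h" and "t = (n - 1/4) / h"
  have ht: "h * s = n" "h * t = n - 1/4" using h_pos by (simp_all add: s_def t_def)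
  have t: "t > 0" using h_pos n_ge by (simp add: t_def)
  have v: "vertex \<tau> 0 = Complex (1/2) t" "vertex \<tau> 1 = Complex 0 s"
    "vertex \<tau> 2 = Complex (-1/2) t" "vertex \<tau> 3 = Complex (-1/2) (-t)"
    "vertex \<tau> 4 = Complex 0 (-s)" "vertex \<tau> 5 = Complex (1/2) (-t)" "vertex \<tau> 6 = Complex (1/2) t"
    by (simp_all add: vertex_def vertex_list num_vertices s_def t_def)
  have m: "edge_midpoint \<tau> 0 = Complex (1/4) ((t + s)/2)" "edge_midpoint \<tau> 1 = Complex (-1/4) ((t + s)/2)"
    "edge_midpoint \<tau> 2 = Complex (-1/2) 0" "edge_midpoint \<tau> 3 = Complex (-1/4) (-(t + s)/2)"
    "edge_midpoint \<tau> 4 = Complex (1/4) (-(t + s)/2)" "edge_midpoint \<tau> 5 = Complex (1/2) 0"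
    by (simp_all add: edge_midpoint_def v midpoint_def complex_eq_iff add.commute flip: One_nat_def)
  have k: "{..<6::nat} = {0,1,2,3,4,5}" "{k. k < (3::nat)} = {0,1,2}" "{1..2::nat} = {1,2}"
    by auto
  have cell: "restricted_voronoi \<tau> =
    {z. \<bar>Re z\<bar> < 1/2 \<and> \<bar>Re z / 2 + h * Im z\<bar> < n \<and> \<bar>Re z / 2 - h * Im z\<bar> < n} \<union>
    (open_segment (Complex (1/4) ((t + s)/2)) (Complex 0 s) \<union>
     open_segment (Complex (-1/4) ((t + s)/2)) (Complex (-1/2) t) \<union>
     open_segment (Complex (-1/2) 0) (Complex (-1/2) (-t)) \<union>
     open_segment (Complex (-1/4) (-(t + s)/2)) (Complex 0 (-s)) \<union>
     open_segment (Complex (1/4) (-(t + s)/2)) (Complex (1/2) (-t)) \<union>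
     open_segment (Complex (1/2) 0) (Complex (1/2) t)) \<union>
    {Complex (1/4) ((t + s)/2), Complex (-1/4) ((t + s)/2), Complex (-1/2) 0} \<union>
    {Complex 0 s, Complex (-1/2) t}"
    unfolding restricted_voronoi_def num_vertices interior_voronoi
    by (simp add: k m v Un_assoc flip: One_nat_def)
  have "h * ((t + s)/2) = n - 1/8" "h * (-(t + s)/2) = 1/8 - n" "h * (-t) = 1/4 - n" "h * (-s) = - n"
    using ht by (simp_all add: field_simps)
  note ht = ht this
  have seg_slanted:
    "z \<in> open_segment (Complex (1/4) ((t + s)/2)) (Complex 0 s) \<longleftrightarrow>
       0 < Re z \<and> Re z < 1/4 \<and> Re z / 2 + h * Im z = n"
    "z \<in> open_segment (Complex (-1/4) ((t + s)/2)) (Complex (-1/2) t) \<longleftrightarrow>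
       -1/2 < Re z \<and> Re z < -1/4 \<and> h * Im z - Re z / 2 = n"
    "z \<in> open_segment (Complex (-1/4) (-(t + s)/2)) (Complex 0 (-s)) \<longleftrightarrow>
       -1/4 < Re z \<and> Re z < 0 \<and> Re z / 2 + h * Im z = - n"
    "z \<in> open_segment (Complex (1/4) (-(t + s)/2)) (Complex (1/2) (-t)) \<longleftrightarrow>
       1/4 < Re z \<and> Re z < 1/2 \<and> h * Im z - Re z / 2 = - n"
    using h_pos by (simp_all only: complex_open_segment_iff[where h = h] complex.sel ht) argo+
  have seg_vertical:
    "z \<in> open_segment (Complex (-1/2) 0) (Complex (-1/2) (-t)) \<longleftrightarrow> Re z = -1/2 \<and> -t < Im z \<and> Im z < 0"
    "z \<in> open_segment (Complex (1/2) 0) (Complex (1/2) t) \<longleftrightarrow> Re z = 1/2 \<and> 0 < Im z \<and> Im z < t"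
    using t by (auto simp: complex_open_segment_vertical_iff)
  have h_iff: "Im z = y \<longleftrightarrow> h * Im z = h * y" "Im z < y \<longleftrightarrow> h * Im z < h * y"
    "y < Im z \<longleftrightarrow> h * y < h * Im z" for y
    using h_pos by simp_all
  have edges:
    "Re z / 2 + h * Im z = n \<and> 0 \<le> Re z \<and> Re z \<le> 1/4 \<longleftrightarrow>
       0 < Re z \<and> Re z < 1/4 \<and> Re z / 2 + h * Im z = n \<or> z = Complex (1/4) ((t + s)/2) \<or> z = Complex 0 s"
    "h * Im z - Re z / 2 = n \<and> -1/2 \<le> Re z \<and> Re z \<le> -1/4 \<longleftrightarrow>
       -1/2 < Re z \<and> Re z < -1/4 \<and> h * Im z - Re z / 2 = n \<or>
       z = Complex (-1/4) ((t + s)/2) \<or> z = Complex (-1/2) t"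
    unfolding complex_eq_iff complex.sel h_iff(1)[of s] h_iff(1)[of t] h_iff(1)[of "(t + s)/2"] ht by argo+
  have edges_vertical:
    "Re z = -1/2 \<and> 1/4 - n < h * Im z \<and> h * Im z \<le> 0 \<longleftrightarrow>
       Re z = -1/2 \<and> -t < Im z \<and> Im z < 0 \<or> z = Complex (-1/2) 0"
    "Re z = 1/2 \<and> 0 < h * Im z \<and> h * Im z < n - 1/4 \<longleftrightarrow>
       Re z = 1/2 \<and> 0 < Im z \<and> Im z < t"
    unfolding complex_eq_iff complex.sel h_iff(1)[of 0] h_iff(2)[of t] h_iff(3)[of "-t"] h_iff(2)[of 0] h_iff(3)[of 0] ht mult_zero_right
    using n_ge by argo+
  show ?thesis
    unfolding hex_cell_def cell edges edges_vertical
    by (simp only: Un_iff mem_Collect_eq insert_iff empty_iff seg_slanted seg_vertical disj_ac conj_ac simp_thms)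
qed

lemma restricted_voronoi_subset: "restricted_voronoi \<tau> \<subseteq> voronoi \<tau>"
  using hex_cell_bounds[OF n_ge] by (auto simp: in_restricted_voronoi in_voronoi)

lemma restricted_voronoi_covers:
  assumes "z \<in> voronoi \<tau>"
  shows "\<exists>u\<in>Z_adjoin \<tau>. z - u \<in> restricted_voronoi \<tau>"
proof -
  obtain i j :: int where "hex_cell n (Re z - (of_int i + of_int j / 2)) (h * Im z - of_int j * (2 * n - 1/4))"
    using hex_cell_covers[OF n_ge] assms in_voronoi by blast
  then have "z - Complex (of_int i + of_int j / 2) (of_int j * h) \<in> restricted_voronoi \<tau>"
    by (simp add: in_restricted_voronoi right_diff_distrib mult.left_commute[of h] h_h)
  then show ?thesis using lattice by blast
qed

lemma restricted_voronoi_disjoint: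
  assumes "z \<in> restricted_voronoi \<tau>" "z - u \<in> restricted_voronoi \<tau>" "u \<in> Z_adjoin \<tau>"
  shows "u = 0"
proof -
  obtain i j :: int where u: "u = Complex (of_int i + of_int j / 2) (of_int j * h)"
    using assms(3) lattice by blast
  have "hex_cell n (Re z - (of_int i + of_int j / 2)) (h * Im z - of_int j * (2 * n - 1/4))"
    using assms(2) by (simp add: u in_restricted_voronoi right_diff_distrib mult.left_commute[of h] h_h)
  then have "i = 0 \<and> j = 0"
    using assms(1) hex_cell_disjoint[OF n_ge] by (simp add: in_restricted_voronoi)
  then show ?thesis by (simp add: u complex_eq_iff)
qed

end

section \<open>Imaginary quadratic orders\<close>

locale imaginary_quadratic =
  fixes p q :: int and \<tau> :: complex
  assumes disc: "4 * q - p ^ 2 > 0"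
    and root: "\<tau> ^ 2 - of_int p * \<tau> + of_int q = 0"
    and expanding: "cmod \<tau> > 1"
begin

section \<open>The norm form and the arithmetic of the ring\<close>

lemma tau_sq: "\<tau> ^ 2 = of_int p * \<tau> - of_int q"
  using root by (simp add: algebra_simps)

lemma tau_nz: "\<tau> \<noteq> 0"
  using expanding by auto

lemma Re_tau: "Re \<tau> = of_int p / 2" and Im_tau_sq: "(Im \<tau>)\<^sup>2 = of_int q - (of_int p)\<^sup>2 / 4"
proof -
  have d: "4 * real_of_int q - (real_of_int p)\<^sup>2 > 0"
  proof -
    have "real_of_int (4 * q - p ^ 2) > 0" using disc by (simp only: of_int_0_less_iff)
    then show ?thesis by simp
  qed
  have re: "(Re \<tau>)\<^sup>2 - (Im \<tau>)\<^sup>2 - of_int p * Re \<tau> + of_int q = 0"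
    and im: "2 * Re \<tau> * Im \<tau> - of_int p * Im \<tau> = 0"
    using arg_cong[OF root, of Re] arg_cong[OF root, of Im] by (simp_all add: power2_eq_square)
  have "Im \<tau> \<noteq> 0"
  proof
    assume "Im \<tau> = 0"
    with re have "(2 * Re \<tau> - of_int p)\<^sup>2 = (of_int p)\<^sup>2 - 4 * of_int q"
      by (simp add: power2_eq_square algebra_simps)
    with d show False
      using zero_le_power2[of "2 * Re \<tau> - of_int p"] by linarith
  qed
  moreover have "(2 * Re \<tau> - of_int p) * Im \<tau> = 0"
    using im by (simp add: algebra_simps)
  ultimately show x: "Re \<tau> = of_int p / 2" by simp
  show "(Im \<tau>)\<^sup>2 = of_int q - (of_int p)\<^sup>2 / 4"
    using re unfolding x by (simp add: power2_eq_square algebra_simps)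
qed

lemma Im_tau_nz: "Im \<tau> \<noteq> 0"
proof
  assume "Im \<tau> = 0"
  then have "4 * real_of_int q - (real_of_int p)\<^sup>2 = 0"
    using Im_tau_sq by simp
  then have "real_of_int (4 * q - p ^ 2) = 0" by simp
  with disc show False by (simp only: of_int_eq_0_iff)
qed

text \<open>The binary quadratic norm form. Its integrality gives both the discreteness of the
  lattice and the measure for termination.\<close>

lemma cmod_sq: "(cmod (of_int a + of_int b * \<tau>))\<^sup>2 = of_int (a\<^sup>2 + a * b * p + b\<^sup>2 * q)"
proof -
  have "(cmod (of_int a + of_int b * \<tau>))\<^sup>2 = (of_int a + of_int b * of_int p / 2)\<^sup>2 + (of_int b)\<^sup>2 * (Im \<tau>)\<^sup>2"
    by (simp add: cmod_power2 Re_tau power_mult_distrib)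
  then show ?thesis
    unfolding Im_tau_sq by (simp add: power2_eq_square field_simps)
qed

lemma cmod_tau_sq: "(cmod \<tau>)\<^sup>2 = of_int q"
  using cmod_sq[of 0 1] by simp

lemma q_ge_2: "q \<ge> 2"
proof -
  have "1 < (cmod \<tau>)\<^sup>2"
    using expanding by simp
  then show ?thesis
    unfolding cmod_tau_sq by linarith
qed

text \<open>Horner's scheme: multiplying by \<tau> produces \<tau>^2, which the quadratic equation
  reduces.\<close>

lemma Z_adjoin_iff: "z \<in> Z_adjoin \<tau> \<longleftrightarrow> (\<exists>a b :: int. z = of_int a + of_int b * \<tau>)"
proof
  assume "z \<in> Z_adjoin \<tau>"
  then obtain f :: "int poly" where "z = poly (map_poly of_int f) \<tau>"
    by (auto simp: Z_adjoin_def)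
  then show "\<exists>a b :: int. z = of_int a + of_int b * \<tau>"
  proof (induction f arbitrary: z)
    case 0
    then show ?case by (auto intro!: exI[of _ 0])
  next
    case (pCons c f)
    obtain a b :: int where ab: "poly (map_poly of_int f) \<tau> = of_int a + of_int b * \<tau>"
      using pCons.IH by blast
    have "z = of_int c + \<tau> * (of_int a + of_int b * \<tau>)"
      using pCons.prems pCons.hyps by (simp add: map_poly_pCons ab)
    also have "\<dots> = of_int c + of_int a * \<tau> + of_int b * \<tau> ^ 2"
      by (simp add: algebra_simps power2_eq_square)
    also have "\<dots> = of_int (c - b * q) + of_int (a + b * p) * \<tau>"
      by (simp add: tau_sq algebra_simps)
    finally show ?case by blast
  qed
next
  assume "\<exists>a b :: int. z = of_int a + of_int b * \<tau>"
  then obtain a b :: int where "z = of_int a + of_int b * \<tau>" by blast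
  then have "z = poly (map_poly of_int [:a, b:]) \<tau>"
    by (simp add: map_poly_pCons)
  then show "z \<in> Z_adjoin \<tau>" by (auto simp: Z_adjoin_def)
qed

lemma Z_adjoin_I: "of_int a + of_int b * \<tau> \<in> Z_adjoin \<tau>"
  by (auto simp: Z_adjoin_iff)

lemma Z_adjoin_0 [simp, intro]: "0 \<in> Z_adjoin \<tau>"
  using Z_adjoin_I[of 0 0] by simp

lemma Z_adjoin_1 [simp, intro]: "1 \<in> Z_adjoin \<tau>"
  using Z_adjoin_I[of 1 0] by simp

lemma Z_adjoin_tau [simp, intro]: "\<tau> \<in> Z_adjoin \<tau>"
  using Z_adjoin_I[of 0 1] by simp

lemma Z_adjoin_add [intro]: "x \<in> Z_adjoin \<tau> \<Longrightarrow> y \<in> Z_adjoin \<tau> \<Longrightarrow> x + y \<in> Z_adjoin \<tau>"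
proof -
  assume "x \<in> Z_adjoin \<tau>" "y \<in> Z_adjoin \<tau>"
  then obtain a b c d :: int where "x = of_int a + of_int b * \<tau>" "y = of_int c + of_int d * \<tau>"
    by (auto simp: Z_adjoin_iff)
  then have "x + y = of_int (a + c) + of_int (b + d) * \<tau>" by (simp add: algebra_simps)
  then show ?thesis by (simp only: Z_adjoin_I)
qed

lemma Z_adjoin_mult [intro]: "x \<in> Z_adjoin \<tau> \<Longrightarrow> y \<in> Z_adjoin \<tau> \<Longrightarrow> x * y \<in> Z_adjoin \<tau>"
proof -
  assume "x \<in> Z_adjoin \<tau>" "y \<in> Z_adjoin \<tau>"
  then obtain a b c d :: int where "x = of_int a + of_int b * \<tau>" "y = of_int c + of_int d * \<tau>"
    by (auto simp: Z_adjoin_iff)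
  then have "x * y = of_int a * of_int c + of_int (a * d + b * c) * \<tau> + of_int (b * d) * \<tau> ^ 2"
    by (simp add: algebra_simps power2_eq_square)
  also have "\<dots> = of_int (a * c - b * d * q) + of_int (a * d + b * c + b * d * p) * \<tau>"
    by (simp add: tau_sq algebra_simps)
  finally show ?thesis by (simp only: Z_adjoin_I)
qed

lemma Z_adjoin_minus [intro]: "x \<in> Z_adjoin \<tau> \<Longrightarrow> - x \<in> Z_adjoin \<tau>"
  using Z_adjoin_mult[of "-1" x] Z_adjoin_I[of "-1" 0] by simp

lemma Z_adjoin_diff [intro]: "x \<in> Z_adjoin \<tau> \<Longrightarrow> y \<in> Z_adjoin \<tau> \<Longrightarrow> x - y \<in> Z_adjoin \<tau>"
  using Z_adjoin_add[of x "- y"] by auto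

lemma Z_adjoin_power [intro]: "x \<in> Z_adjoin \<tau> \<Longrightarrow> x ^ n \<in> Z_adjoin \<tau>"
  by (induction n) auto

lemma int_norm:
  assumes "z \<in> Z_adjoin \<tau>"
  obtains n :: nat where "(cmod z)\<^sup>2 = real n"
proof -
  obtain a b :: int where "z = of_int a + of_int b * \<tau>"
    using assms by (auto simp: Z_adjoin_iff)
  then obtain k :: int where k: "(cmod z)\<^sup>2 = of_int k"
    using cmod_sq by blast
  then have "k \<ge> 0" by (metis of_int_0_le_iff zero_le_power2)
  then have "(cmod z)\<^sup>2 = real (nat k)" by (simp add: k)
  then show thesis by (rule that)
qed

text \<open>Nonzero elements have integral norm at least 1. Closedness is what makes a nearest
  lattice point exist.\<close>

lemma closed_lattice: "closed (Z_adjoin \<tau>)"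
proof (rule discrete_imp_closed[of 1])
  show "\<forall>x\<in>Z_adjoin \<tau>. \<forall>y\<in>Z_adjoin \<tau>. dist y x < 1 \<longrightarrow> y = x"
  proof (intro ballI impI)
    fix x y assume "x \<in> Z_adjoin \<tau>" "y \<in> Z_adjoin \<tau>" and less: "dist y x < 1"
    then obtain n where n: "(cmod (y - x))\<^sup>2 = real n"
      using int_norm[of "y - x"] by blast
    have "(cmod (y - x))\<^sup>2 < 1"
      using less by (simp add: dist_norm power_less_one_iff)
    with n have "n = 0" by simp
    with n show "y = x" by simp
  qed
qed simp

lemma nearest_lattice_point: "\<exists>u\<in>Z_adjoin \<tau>. z - u \<in> voronoi \<tau>"
proof -
  obtain u where u: "u \<in> Z_adjoin \<tau>" "\<And>y. y \<in> Z_adjoin \<tau> \<Longrightarrow> dist z u \<le> dist z y"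
    using distance_attains_inf[OF closed_lattice, of z] by blast
  have "cmod (z - u) \<le> cmod (z - u - y)" if "y \<in> Z_adjoin \<tau>" for y
    using u(2)[of "u + y"] u(1) that by (auto simp: dist_norm algebra_simps)
  with u(1) show ?thesis by (auto simp: voronoi_def)
qed

text \<open>The product of \<tau> and c + d \<tau> is -d q + (c + d p) \<tau>, so the multiples of
  \<tau> are spanned by q and \<tau>.\<close>

lemma tau_dvd_iff: "Z_dvd \<tau> \<tau> (of_int a + of_int b * \<tau>) \<longleftrightarrow> q dvd a"
proof
  assume "Z_dvd \<tau> \<tau> (of_int a + of_int b * \<tau>)"
  then obtain e where "e \<in> Z_adjoin \<tau>" and ab: "of_int a + of_int b * \<tau> = \<tau> * e"
    unfolding Z_dvd_def by blast
  then obtain c d where e: "e = of_int c + of_int d * \<tau>"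
    using Z_adjoin_iff by blast
  note ab
  also have "\<tau> * e = of_int c * \<tau> + of_int d * \<tau>\<^sup>2"
    by (simp add: e algebra_simps power2_eq_square)
  also have "\<dots> = of_int (- d * q) + of_int (c + d * p) * \<tau>"
    by (simp add: tau_sq algebra_simps)
  finally have eq: "of_int a + of_int b * \<tau> = of_int (- d * q) + of_int (c + d * p) * \<tau>" .
  from arg_cong[OF eq, of Im] have "real_of_int b = of_int (c + d * p)"
    using Im_tau_nz by simp
  then have "b = c + d * p" by (simp only: of_int_eq_iff)
  with eq have "a = - d * q" by (simp only: add_right_cancel of_int_eq_iff)
  then show "q dvd a" by simp
next
  assume "q dvd a"
  then obtain d where "a = q * d" by blast
  moreover have "\<tau> * (of_int (d * p + b) + of_int (- d) * \<tau>) = of_int (d * p + b) * \<tau> - of_int d * \<tau>\<^sup>2"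
    by (simp add: algebra_simps power2_eq_square)
  ultimately have "of_int a + of_int b * \<tau> = \<tau> * (of_int (d * p + b) + of_int (- d) * \<tau>)"
    unfolding tau_sq by (simp add: algebra_simps)
  then show "Z_dvd \<tau> \<tau> (of_int a + of_int b * \<tau>)"
    using Z_adjoin_I by (auto simp: Z_dvd_def simp del: of_int_add of_int_minus of_int_mult)
qed

text \<open>\<tau> - p/2 lies in the lattice and is purely imaginary; the absolute value covers both
  choices of the root.\<close>

lemma even_p_rectangular:
  assumes "even p"
  shows "rectangular_lattice \<tau> \<bar>Im \<tau>\<bar>"
proof
  show "\<bar>Im \<tau>\<bar> > 0" using Im_tau_nz by simp
  obtain k where k: "p = 2 * k" using assms by blast
  have eq: "of_int a + of_int b * \<tau> = Complex (of_int (a + b * k)) (of_int b * Im \<tau>)" for a b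
    by (simp add: complex_eq_iff Re_tau k)
  fix z
  show "z \<in> Z_adjoin \<tau> \<longleftrightarrow> (\<exists>i j :: int. z = Complex (of_int i) (of_int j * \<bar>Im \<tau>\<bar>))"
  proof
    assume "z \<in> Z_adjoin \<tau>"
    then obtain a b where "z = Complex (of_int (a + b * k)) (of_int b * Im \<tau>)"
      unfolding Z_adjoin_iff eq by blast
    then have "z = Complex (of_int (a + b * k)) (of_int (if Im \<tau> < 0 then - b else b) * \<bar>Im \<tau>\<bar>)"
      by simp
    then show "\<exists>i j :: int. z = Complex (of_int i) (of_int j * \<bar>Im \<tau>\<bar>)" by blast
  next
    assume "\<exists>i j :: int. z = Complex (of_int i) (of_int j * \<bar>Im \<tau>\<bar>)"
    then obtain i j :: int where "z = Complex (of_int i) (of_int j * \<bar>Im \<tau>\<bar>)" by blast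
    moreover define b where "b = (if Im \<tau> < 0 then - j else j)"
    ultimately have "z = Complex (of_int ((i - b * k) + b * k)) (of_int b * Im \<tau>)"
      by simp
    then show "z \<in> Z_adjoin \<tau>" unfolding Z_adjoin_iff eq by blast
  qed
qed

text \<open>\<tau> - (p - 1)/2 lies in the lattice and has real part 1/2.\<close>

lemma odd_p_hexagonal:
  assumes "odd p"
  shows "hexagonal_lattice \<tau> \<bar>Im \<tau>\<bar>"
proof
  show "\<bar>Im \<tau>\<bar> > 0" using Im_tau_nz by simp
  obtain k where k: "p = 2 * k + 1" using assms by (elim oddE)
  \<comment> \<open>A positive integer congruent to -1 modulo 4 is at least 3, which is the source
    of 3/4.\<close>
  have "4 * q - p\<^sup>2 = 4 * (q - k\<^sup>2 - k) - 1"
    by (simp add: k power2_eq_square algebra_simps)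
  moreover have "3 \<le> 4 * m - 1" if "0 < 4 * m - 1" for m :: int
    using that by presburger
  ultimately have "4 * q - p\<^sup>2 \<ge> 3" using disc by metis
  then have "real_of_int (4 * q - p\<^sup>2) \<ge> 3" by linarith
  then show "\<bar>Im \<tau>\<bar>\<^sup>2 \<ge> 3/4"
    by (simp add: Im_tau_sq)
  have eq: "of_int a + of_int b * \<tau> = Complex (of_int (a + b * k) + of_int b / 2) (of_int b * Im \<tau>)" for a b
    by (simp add: complex_eq_iff Re_tau k field_simps)
  fix z
  show "z \<in> Z_adjoin \<tau> \<longleftrightarrow> (\<exists>i j :: int. z = Complex (of_int i + of_int j / 2) (of_int j * \<bar>Im \<tau>\<bar>))"
  proof
    assume "z \<in> Z_adjoin \<tau>"
    then obtain a b where z: "z = Complex (of_int (a + b * k) + of_int b / 2) (of_int b * Im \<tau>)"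
      unfolding Z_adjoin_iff eq by blast
    show "\<exists>i j :: int. z = Complex (of_int i + of_int j / 2) (of_int j * \<bar>Im \<tau>\<bar>)"
    proof (cases "Im \<tau> < 0")
      case True
      \<comment> \<open>Changing the sign of b turns b/2 into -b/2; the extra b in the integral part
        compensates.\<close>
      then have "z = Complex (of_int (a + b * k + b) + of_int (- b) / 2) (of_int (- b) * \<bar>Im \<tau>\<bar>)"
        by (simp add: z)
      then show ?thesis by blast
    next
      case False
      then have "z = Complex (of_int (a + b * k) + of_int b / 2) (of_int b * \<bar>Im \<tau>\<bar>)"
        by (simp add: z)
      then show ?thesis by blast
    qed
  next
    assume "\<exists>i j :: int. z = Complex (of_int i + of_int j / 2) (of_int j * \<bar>Im \<tau>\<bar>)"
    then obtain i j :: int where z: "z = Complex (of_int i + of_int j / 2) (of_int j * \<bar>Im \<tau>\<bar>)" by blast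
    have "z = Complex (of_int ((i + j + j * k) + (- j) * k) + of_int (- j) / 2) (of_int (- j) * Im \<tau>)" if "Im \<tau> < 0"
      using that by (simp add: z)
    moreover have "z = Complex (of_int ((i - j * k) + j * k) + of_int j / 2) (of_int j * Im \<tau>)" if "\<not> Im \<tau> < 0"
      using that by (simp add: z)
    ultimately show "z \<in> Z_adjoin \<tau>" unfolding Z_adjoin_iff eq by blast
  qed
qed

section \<open>Tiling of the plane, independent of the parity of p\<close>

lemma restricted_voronoi_subset: "restricted_voronoi \<tau> \<subseteq> voronoi \<tau>"
  using rectangular_lattice.restricted_voronoi_subset[OF even_p_rectangular]
    hexagonal_lattice.restricted_voronoi_subset[OF odd_p_hexagonal] by (cases "even p") auto

lemma restricted_voronoi_disjoint:
  assumes "z \<in> restricted_voronoi \<tau>" "z - u \<in> restricted_voronoi \<tau>" "u \<in> Z_adjoin \<tau>"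
  shows "u = 0"
  using rectangular_lattice.restricted_voronoi_disjoint[OF even_p_rectangular assms]
    hexagonal_lattice.restricted_voronoi_disjoint[OF odd_p_hexagonal assms] by (cases "even p") auto

text \<open>Subtracting a nearest lattice point reaches the closed cell; a second lattice vector
  corrects the position on the boundary.\<close>

lemma tiling: "\<exists>!u. u \<in> Z_adjoin \<tau> \<and> z - u \<in> restricted_voronoi \<tau>"
proof -
  obtain u where u: "u \<in> Z_adjoin \<tau>" "z - u \<in> voronoi \<tau>"
    using nearest_lattice_point by blast
  then obtain v where v: "v \<in> Z_adjoin \<tau>" "z - u - v \<in> restricted_voronoi \<tau>"
    using rectangular_lattice.restricted_voronoi_covers[OF even_p_rectangular u(2)]
      hexagonal_lattice.restricted_voronoi_covers[OF odd_p_hexagonal u(2)] by (cases "even p") auto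
  show ?thesis
  proof (rule ex1I[of _ "u + v"])
    show "u + v \<in> Z_adjoin \<tau> \<and> z - (u + v) \<in> restricted_voronoi \<tau>"
      using u v by (auto simp: diff_diff_eq)
    fix x assume x: "x \<in> Z_adjoin \<tau> \<and> z - x \<in> restricted_voronoi \<tau>"
    have "z - (u + v) - (x - (u + v)) \<in> restricted_voronoi \<tau>" "x - (u + v) \<in> Z_adjoin \<tau>"
      using x u v by auto
    then have "x - (u + v) = 0"
      using v(2) by (intro restricted_voronoi_disjoint[of "z - (u + v)"]) (simp_all add: diff_diff_eq)
    then show "x = u + v" by simp
  qed
qed

lemma cong_iff_mult: "Z_cong \<tau> n a b \<longleftrightarrow> (\<exists>c\<in>Z_adjoin \<tau>. a = b + \<tau> ^ n * c)"
  by (auto simp: Z_cong_def Z_dvd_def algebra_simps)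

lemma tau_dvd_cong:
  assumes "Z_cong \<tau> n a b" "n > 0"
  shows "Z_dvd \<tau> \<tau> a \<longleftrightarrow> Z_dvd \<tau> \<tau> b"
proof -
  obtain c where c: "c \<in> Z_adjoin \<tau>" "a = b + \<tau> ^ n * c"
    using assms(1) by (auto simp: cong_iff_mult)
  obtain m where "n = Suc m" using assms(2) gr0_implies_Suc by blast
  then have a: "a = b + \<tau> * (\<tau> ^ m * c)" "b = a + \<tau> * (- (\<tau> ^ m * c))"
    using c by simp_all
  have "\<tau> ^ m * c \<in> Z_adjoin \<tau>" using c by blast
  then have "Z_dvd \<tau> \<tau> (x + \<tau> * (\<tau> ^ m * c))" "Z_dvd \<tau> \<tau> (x + \<tau> * (- (\<tau> ^ m * c)))" if "Z_dvd \<tau> \<tau> x" for x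
    using that by (auto simp: Z_dvd_def simp flip: distrib_left right_diff_distrib)
  then show ?thesis using a by metis
qed

lemma tau_dvd_mult: "c \<in> Z_adjoin \<tau> \<Longrightarrow> Z_dvd \<tau> \<tau> (\<tau> * c)"
  by (auto simp: Z_dvd_def)

lemma tau_dvd_0: "Z_dvd \<tau> \<tau> 0"
  using tau_dvd_mult[of 0] by simp

end

section \<open>Non-adjacent forms\<close>

text \<open>One loop pass on \<open>y\<close> alone. Since it fixes 0, its iterates make sense
  beyond the end of the loop.\<close>

definition naf_step :: "complex \<Rightarrow> nat \<Rightarrow> complex \<Rightarrow> complex" where
  "naf_step \<tau> w y = (y - next_digit \<tau> w y) / \<tau>"

locale naf_base = imaginary_quadratic +
  fixes w :: nat
  assumes w_ge_2: "w \<ge> 2"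
begin

section \<open>Digits and the digit choice\<close>

abbreviation "cell_representatives y \<equiv> residue_class \<tau> w y \<inter> (\<lambda>z. \<tau> ^ w * z) ` restricted_voronoi \<tau>"

lemma in_cell_representatives:
  "d \<in> cell_representatives y \<longleftrightarrow> d \<in> Z_adjoin \<tau> \<and> Z_cong \<tau> w d y \<and> d / \<tau> ^ w \<in> restricted_voronoi \<tau>"
  using tau_nz by (auto simp: residue_class_def intro!: image_eqI[of _ _ "d / \<tau> ^ w"])

text \<open>The tiling at y / \<tau>^w: its lattice vector u corresponds to the representative y -
  \<tau>^w u.\<close>

lemma ex1_cell_representative:
  assumes "y \<in> Z_adjoin \<tau>"
  shows "\<exists>!d. d \<in> cell_representatives y"
proof -
  obtain u where u: "u \<in> Z_adjoin \<tau>" "y / \<tau> ^ w - u \<in> restricted_voronoi \<tau>"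
    and uniq: "\<And>x. x \<in> Z_adjoin \<tau> \<Longrightarrow> y / \<tau> ^ w - x \<in> restricted_voronoi \<tau> \<Longrightarrow> x = u"
    using tiling[of "y / \<tau> ^ w"] by blast
  show ?thesis
  proof (rule ex1I[of _ "y - \<tau> ^ w * u"])
    have "y - \<tau> ^ w * u = y + \<tau> ^ w * (- u)" by simp
    then have "Z_cong \<tau> w (y - \<tau> ^ w * u) y"
      unfolding cong_iff_mult using u(1) by blast
    then show "y - \<tau> ^ w * u \<in> cell_representatives y"
      unfolding in_cell_representatives using u assms tau_nz by (auto simp: diff_divide_distrib)
    fix d assume "d \<in> cell_representatives y"
    then obtain c where c: "c \<in> Z_adjoin \<tau>" "d = y + \<tau> ^ w * c" "d / \<tau> ^ w \<in> restricted_voronoi \<tau>"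
      unfolding in_cell_representatives cong_iff_mult by blast
    then have "- c = u"
      using tau_nz by (intro uniq) (auto simp: add_divide_distrib)
    then show "d = y - \<tau> ^ w * u" using c by auto
  qed
qed

text \<open>A digit represents its own class, and divisibility by \<tau> depends only on the class,
  so the auxiliary representative disappears.\<close>

lemma in_digits_iff:
  "d \<in> digits \<tau> w \<longleftrightarrow> d = 0 \<or> d \<in> Z_adjoin \<tau> \<and> \<not> Z_dvd \<tau> \<tau> d \<and> d / \<tau> ^ w \<in> restricted_voronoi \<tau>"
proof -
  have the: "the_elem (cell_representatives x) = d \<longleftrightarrow> d \<in> cell_representatives x" if "x \<in> Z_adjoin \<tau>" for x d
  proof -
    obtain e where "\<And>d. d \<in> cell_representatives x \<longleftrightarrow> d = e"
      using ex1_cell_representative[OF \<open>x \<in> Z_adjoin \<tau>\<close>] by metis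
    then have "cell_representatives x = {e}" by blast
    then show ?thesis by auto
  qed
  have refl: "Z_cong \<tau> w d d" unfolding cong_iff_mult by (intro bexI[of _ 0]) auto
  have "(\<exists>x. d = the_elem (cell_representatives x) \<and> x \<in> Z_adjoin \<tau> \<and> \<not> Z_dvd \<tau> \<tau> x)
    \<longleftrightarrow> (\<exists>x. d \<in> cell_representatives x \<and> x \<in> Z_adjoin \<tau> \<and> \<not> Z_dvd \<tau> \<tau> x)"
    using the by metis
  also have "\<dots> \<longleftrightarrow> d \<in> Z_adjoin \<tau> \<and> \<not> Z_dvd \<tau> \<tau> d \<and> d / \<tau> ^ w \<in> restricted_voronoi \<tau>"
  proof -
    have "\<not> Z_dvd \<tau> \<tau> d" if "Z_cong \<tau> w d x" "\<not> Z_dvd \<tau> \<tau> x" for x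
      using tau_dvd_cong[OF that(1)] that(2) w_ge_2 by simp
    then show ?thesis
      using refl unfolding in_cell_representatives by blast
  qed
  finally show ?thesis unfolding digits_def by auto
qed

lemma digits_subset: "d \<in> digits \<tau> w \<Longrightarrow> d \<in> Z_adjoin \<tau>"
  by (auto simp: in_digits_iff)

lemma ex1_digit:
  assumes "y \<in> Z_adjoin \<tau>" "\<not> Z_dvd \<tau> \<tau> y"
  shows "\<exists>!d. d \<in> digits \<tau> w \<and> Z_cong \<tau> w d y"
proof -
  have "d \<in> digits \<tau> w \<and> Z_cong \<tau> w d y \<longleftrightarrow> d \<in> cell_representatives y" for d
    using assms tau_dvd_cong[of w d y] w_ge_2 tau_dvd_0 unfolding in_cell_representatives in_digits_iff
    by auto
  then show ?thesis using ex1_cell_representative[OF assms(1)] by simp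
qed

lemma next_digit:
  assumes "y \<in> Z_adjoin \<tau>" "\<not> Z_dvd \<tau> \<tau> y"
  shows "next_digit \<tau> w y \<in> digits \<tau> w" "Z_cong \<tau> w (next_digit \<tau> w y) y"
  using theI'[OF ex1_digit[OF assms]] assms(2) by (auto simp: next_digit_def)

lemma next_digit_eqI:
  assumes "y \<in> Z_adjoin \<tau>" "\<not> Z_dvd \<tau> \<tau> y" "d \<in> digits \<tau> w" "Z_cong \<tau> w d y"
  shows "next_digit \<tau> w y = d"
  using ex1_digit[OF assms(1,2)] next_digit[OF assms(1,2)] assms(3,4) by blast

lemma next_digit_in_digits: "y \<in> Z_adjoin \<tau> \<Longrightarrow> next_digit \<tau> w y \<in> digits \<tau> w"
  using next_digit(1) in_digits_iff[of 0] by (cases "Z_dvd \<tau> \<tau> y") (auto simp: next_digit_def)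

lemma naf_step_mult: "c \<in> Z_adjoin \<tau> \<Longrightarrow> naf_step \<tau> w (\<tau> * c) = c"
  using tau_nz by (simp add: naf_step_def next_digit_def tau_dvd_mult)

text \<open>After a nonzero digit the next w - 1 steps merely divide by \<tau>. The block of w
  steps, k = w - 1, ends at \<open>c\<close>.\<close>

lemma naf_steps_not_dvd:
  assumes "y \<in> Z_adjoin \<tau>" "\<not> Z_dvd \<tau> \<tau> y"
  obtains c where "c \<in> Z_adjoin \<tau>" "y = next_digit \<tau> w y + \<tau> ^ w * c"
    "\<forall>k<w. (naf_step \<tau> w ^^ Suc k) y = \<tau> ^ (w - 1 - k) * c"
proof -
  obtain c' where c': "c' \<in> Z_adjoin \<tau>" "next_digit \<tau> w y = y + \<tau> ^ w * c'"
    using next_digit(2)[OF assms] unfolding cong_iff_mult by blast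
  define c where "c = - c'"
  have c: "c \<in> Z_adjoin \<tau>" "y - next_digit \<tau> w y = \<tau> ^ w * c"
    using c' by (auto simp: c_def)
  have "(naf_step \<tau> w ^^ Suc k) y = \<tau> ^ (w - 1 - k) * c" if "k < w" for k
    using that
  proof (induction k)
    case 0
    obtain m where "w = Suc m" using w_ge_2 by (cases w) auto
    then show ?case using c tau_nz by (simp add: naf_step_def)
  next
    case (Suc k)
    then have "w - 1 - k = Suc (w - 1 - Suc k)" by simp
    then have "(naf_step \<tau> w ^^ Suc k) y = \<tau> * (\<tau> ^ (w - 1 - Suc k) * c)"
      using Suc by simp
    moreover have "\<tau> ^ (w - 1 - Suc k) * c \<in> Z_adjoin \<tau>" using c by blast
    ultimately show ?case by (simp add: naf_step_mult)
  qed
  moreover have "y = next_digit \<tau> w y + \<tau> ^ w * c" using c by (simp add: algebra_simps)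
  ultimately show thesis using c(1) that by blast
qed

lemma naf_step_in_Z: "y \<in> Z_adjoin \<tau> \<Longrightarrow> naf_step \<tau> w y \<in> Z_adjoin \<tau>"
proof -
  assume y: "y \<in> Z_adjoin \<tau>"
  show ?thesis
  proof (cases "Z_dvd \<tau> \<tau> y")
    case True
    then show ?thesis unfolding Z_dvd_def by (auto simp: naf_step_mult)
  next
    case False
    obtain c where c: "c \<in> Z_adjoin \<tau>" "y = next_digit \<tau> w y + \<tau> ^ w * c"
      "\<forall>k<w. (naf_step \<tau> w ^^ Suc k) y = \<tau> ^ (w - 1 - k) * c"
      by (rule naf_steps_not_dvd[OF y False])
    from c(3)[rule_format, of 0] have "naf_step \<tau> w y = \<tau> ^ (w - 1) * c" using w_ge_2 by simp
    then show ?thesis using c(1) by auto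
  qed
qed

lemma naf_steps_in_Z: "y \<in> Z_adjoin \<tau> \<Longrightarrow> (naf_step \<tau> w ^^ k) y \<in> Z_adjoin \<tau>"
  by (induction k) (auto intro: naf_step_in_Z)

lemma next_digit_after_nonzero:
  assumes "y \<in> Z_adjoin \<tau>" "next_digit \<tau> w y \<noteq> 0" "0 < k" "k < w"
  shows "next_digit \<tau> w ((naf_step \<tau> w ^^ k) y) = 0"
proof -
  have nd: "\<not> Z_dvd \<tau> \<tau> y" using assms(2) by (auto simp: next_digit_def)
  obtain c where c: "c \<in> Z_adjoin \<tau>" "y = next_digit \<tau> w y + \<tau> ^ w * c"
    "\<forall>k<w. (naf_step \<tau> w ^^ Suc k) y = \<tau> ^ (w - 1 - k) * c"
    by (rule naf_steps_not_dvd[OF assms(1) nd])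
  obtain m where m: "k = Suc m" using assms(3) gr0_implies_Suc by blast
  then have "w - 1 - m = Suc (w - 2 - m)" using assms(4) by simp
  then have "(naf_step \<tau> w ^^ k) y = \<tau> * (\<tau> ^ (w - 2 - m) * c)"
    using c(3)[rule_format, of m] m assms(4) by simp
  moreover have "\<tau> ^ (w - 2 - m) * c \<in> Z_adjoin \<tau>" using c(1) by blast
  ultimately show ?thesis by (simp add: next_digit_def tau_dvd_mult)
qed

text \<open>With z = y / \<tau>^w and scaled digit v one has z = v + c. As v is no farther from 0
  than from -c, |v| is at most |z|, whence |c| is at most 2 |z|.\<close>

lemma naf_steps_contract:
  assumes "y \<in> Z_adjoin \<tau>" "\<not> Z_dvd \<tau> \<tau> y"
  defines "c \<equiv> (naf_step \<tau> w ^^ w) y"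
  shows "cmod c < cmod y \<or>
    q = 2 \<and> cmod c = cmod y \<and> \<tau>\<^sup>2 * c = 2 * y \<and> - c / 2 \<in> restricted_voronoi \<tau>"
proof -
  obtain c' where c': "c' \<in> Z_adjoin \<tau>" "y = next_digit \<tau> w y + \<tau> ^ w * c'"
    "\<forall>k<w. (naf_step \<tau> w ^^ Suc k) y = \<tau> ^ (w - 1 - k) * c'"
    by (rule naf_steps_not_dvd[OF assms(1,2)])
  have "c = c'"
    using c'(3)[rule_format, of "w - 1"] w_ge_2 by (simp add: c_def)
  note c = c'(1,2)[folded this]
  have "y \<noteq> 0" using assms(2) tau_dvd_0 by auto
  define z where "z = y / \<tau> ^ w"
  define v where "v = next_digit \<tau> w y / \<tau> ^ w"
  have zvc: "z = v + c"
    using tau_nz by (subst z_def, subst c(2)) (simp add: v_def add_divide_distrib)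
  have "next_digit \<tau> w y \<noteq> 0"
    using tau_dvd_cong[OF next_digit(2)[OF assms(1,2)]] w_ge_2 tau_dvd_0 assms(2) by auto
  then have v: "v \<in> restricted_voronoi \<tau>"
    using next_digit(1)[OF assms(1,2)] by (simp add: in_digits_iff v_def)
  have "- c \<in> Z_adjoin \<tau>" using c(1) by blast
  then have "cmod v \<le> cmod (v - (- c))"
    using v restricted_voronoi_subset unfolding voronoi_def by blast
  then have vz: "cmod v \<le> cmod z" by (simp add: zvc)
  have "cmod c \<le> cmod z + cmod v"
    using norm_triangle_ineq4[of z v] by (simp add: zvc)
  with vz have cz: "cmod c \<le> 2 * cmod z" by simp
  have yz: "cmod y = cmod \<tau> ^ w * cmod z"
    using tau_nz by (simp add: z_def norm_divide norm_power)
  have "z \<noteq> 0" using \<open>y \<noteq> 0\<close> tau_nz by (simp add: z_def)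
  show ?thesis
  proof (cases "cmod \<tau> ^ w > 2")
    case True
    then have "2 * cmod z < cmod y"
      using \<open>z \<noteq> 0\<close> by (simp add: yz)
    with cz show ?thesis by simp
  next
    case False
    \<comment> \<open>|\<tau>|^w is at least q, hence at least 2, so failure of the strict bound
      forces q = 2 and then w = 2.\<close>
    have qle: "real_of_int q \<le> cmod \<tau> ^ w"
      using power_increasing[of 2 w "cmod \<tau>"] expanding w_ge_2 by (simp add: cmod_tau_sq)
    with False q_ge_2 have q: "q = 2" by linarith
    have w: "w = 2"
    proof (rule ccontr)
      assume "w \<noteq> 2"
      with w_ge_2 have "cmod \<tau> ^ 2 < cmod \<tau> ^ w"
        using expanding by (intro power_strict_increasing) auto
      with False q show False by (simp add: cmod_tau_sq)
    qed
    have yz2: "cmod y = 2 * cmod z" by (simp add: yz w cmod_tau_sq q)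
    show ?thesis
    proof (cases "cmod c < cmod y")
      case False
      with cz yz2 have cc: "cmod c = 2 * cmod z" by simp
      \<comment> \<open>The parallelogram law turns equality of norms into z + v = 0.\<close>
      have "(cmod (z + v))\<^sup>2 = 2 * (cmod z)\<^sup>2 + 2 * (cmod v)\<^sup>2 - (cmod (z - v))\<^sup>2"
        unfolding cmod_power2 by (simp add: power2_eq_square algebra_simps)
      also have "z - v = c" by (simp add: zvc)
      also have "2 * (cmod z)\<^sup>2 + 2 * (cmod v)\<^sup>2 - (cmod c)\<^sup>2 \<le> 0"
        using power_mono[OF vz, of 2] by (simp add: cc power_mult_distrib)
      finally have "z + v = 0" by simp
      then have "v = - z" by (simp add: eq_neg_iff_add_eq_0 add.commute)
      with zvc have "c = 2 * z" by simp
      then have "\<tau>\<^sup>2 * c = 2 * y" "- c / 2 = v"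
        using tau_nz \<open>v = - z\<close> by (simp_all add: z_def w)
      with v cc yz2 q show ?thesis by simp
    qed simp
  qed
qed

text \<open>The loop could only get stuck by multiplying by the root of unity \<open>2 / \<tau>\<^sup>2\<close> forever; some
  power of it is \<open>-1\<close>, and then both halves \<open>\<plusminus> y / 2\<close> would lie in the restricted cell.\<close>

lemma not_stuck_thrice:
  assumes Z: "y0 \<in> Z_adjoin \<tau>" "y1 \<in> Z_adjoin \<tau>"
    and nd: "\<not> Z_dvd \<tau> \<tau> y0" "\<not> Z_dvd \<tau> \<tau> y1"
    and q: "q = 2"
    and eq: "\<tau>\<^sup>2 * y1 = 2 * y0" "\<tau>\<^sup>2 * y2 = 2 * y1" "\<tau>\<^sup>2 * y3 = 2 * y2"
    and cell: "- y1 / 2 \<in> restricted_voronoi \<tau>" "- y2 / 2 \<in> restricted_voronoi \<tau>"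
      "- y3 / 2 \<in> restricted_voronoi \<tau>"
  shows False
proof -
  \<comment> \<open>2 is the norm of \<tau>, and p - \<tau> is its conjugate.\<close>
  have two: "2 = \<tau> * (of_int p - \<tau>)"
    using tau_sq q by (simp add: algebra_simps power2_eq_square)
  obtain a b where ab: "y0 = of_int a + of_int b * \<tau>"
    using Z(1) Z_adjoin_iff by blast
  have "\<tau> * (\<tau> * y1) = \<tau> * ((of_int p - \<tau>) * y0)"
    using eq(1) two by (simp add: power2_eq_square mult.assoc)
  then have "\<tau> * y1 = (of_int p - \<tau>) * y0" using tau_nz by simp
  \<comment> \<open>Thus \<tau> divides p * y0 but not y0; as \<tau> has norm 2, p must be
    even.\<close>
  then have "of_int (p * a) + of_int (p * b) * \<tau> = \<tau> * (y1 + y0)"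
    by (simp add: ab algebra_simps)
  then have "Z_dvd \<tau> \<tau> (of_int (p * a) + of_int (p * b) * \<tau>)"
    using tau_dvd_mult Z by auto
  then have "2 dvd p * a" using tau_dvd_iff q by metis
  moreover have "\<not> 2 dvd a" using nd(1) tau_dvd_iff q ab by simp
  ultimately have "even p" by simp
  have "p\<^sup>2 < 3\<^sup>2" using disc q by simp
  then have "\<bar>p\<bar> < 3" using power2_less_imp_less[of "\<bar>p\<bar>" 3] by simp
  with \<open>even p\<close> have "p = 0 \<or> p = 2 \<or> p = -2" by presburger
  \<comment> \<open>-y1 / 2 and y1 / 2 differ by y1, a lattice point that is nonzero because \<tau>
    does not divide it.\<close>
  moreover have "- y1 / 2 - (- y1) \<notin> restricted_voronoi \<tau>"
    using restricted_voronoi_disjoint[OF cell(1), of "- y1"] Z(2) nd(2) tau_dvd_0 by auto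
  then have "y2 \<noteq> - y1" "y3 \<noteq> - y1"
    using cell(2,3) by (auto simp: field_simps)
  \<comment> \<open>For p = 0 the factor 2 / \<tau>^2 is -1; for p = 2 or -2 only its square is -1,
    since \<tau>^4 = -4.\<close>
  moreover have "y2 = - y1" if "p = 0"
    using eq(2) tau_sq that q by auto
  moreover have "y3 = - y1" if "p = 2 \<or> p = -2"
  proof -
    have "(\<tau>\<^sup>2)\<^sup>2 = (of_int p * \<tau> - 2)\<^sup>2"
      by (simp add: tau_sq q)
    also have "\<dots> = (of_int p)\<^sup>2 * \<tau>\<^sup>2 - 4 * of_int p * \<tau> + 4"
      by (simp add: power2_eq_square algebra_simps)
    also have "\<dots> = - 4"
      unfolding tau_sq using that q by auto
    finally have "(\<tau>\<^sup>2)\<^sup>2 = - 4" .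
    moreover have "(\<tau>\<^sup>2)\<^sup>2 * y3 = 4 * y1"
      using eq(2,3) by (simp add: power2_eq_square mult.assoc)
    ultimately show ?thesis by (simp add: minus_equation_iff)
  qed
  ultimately show False by blast
qed

text \<open>Strong induction on the integral norm: if y does not halt while all smaller norms do,
  every block of w steps stays in the equality case. Three blocks are needed because for p = 2 or -2
  the sign change occurs only between y1 and y3.\<close>

lemma naf_terminates:
  assumes "y \<in> Z_adjoin \<tau>"
  shows "\<exists>n. (naf_step \<tau> w ^^ n) y = 0"
proof -
  define halts where "halts y \<longleftrightarrow> (\<exists>n. (naf_step \<tau> w ^^ n) y = 0)" for y
  have halts_steps: "halts y" if "halts ((naf_step \<tau> w ^^ k) y)" for k y
    using that unfolding halts_def by (metis funpow_add o_apply)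
  obtain N where "(cmod y)\<^sup>2 = real N" by (rule int_norm[OF assms])
  then have "halts y"
    using assms
  proof (induction N arbitrary: y rule: less_induct)
    case (less N)
    have smaller: "halts x" if "x \<in> Z_adjoin \<tau>" "cmod x < cmod y" for x
    proof -
      obtain M where M: "(cmod x)\<^sup>2 = real M" by (rule int_norm[OF \<open>x \<in> Z_adjoin \<tau>\<close>])
      have "(cmod x)\<^sup>2 < (cmod y)\<^sup>2" using that(2) by (intro power_strict_mono) auto
      then show ?thesis using less M that(1) by auto
    qed
    have stuck: "\<not> Z_dvd \<tau> \<tau> x \<and> x' \<in> Z_adjoin \<tau> \<and> cmod x' = cmod y \<and> \<not> halts x' \<and>
        q = 2 \<and> \<tau>\<^sup>2 * x' = 2 * x \<and> - x' / 2 \<in> restricted_voronoi \<tau>"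
      if x: "x \<in> Z_adjoin \<tau>" "cmod x = cmod y" "\<not> halts x" and x': "x' = (naf_step \<tau> w ^^ w) x" for x x'
    proof -
      have "halts 0" unfolding halts_def by (rule exI[of _ 0]) simp
      then have "x \<noteq> 0" using x(3) by auto
      \<comment> \<open>Dividing by \<tau> lowers the norm, so a non-halting element of this norm is
        not divisible.\<close>
      have nd: "\<not> Z_dvd \<tau> \<tau> x"
      proof
        assume "Z_dvd \<tau> \<tau> x"
        then obtain c where c: "c \<in> Z_adjoin \<tau>" "x = \<tau> * c" by (auto simp: Z_dvd_def)
        then have "c \<noteq> 0" using \<open>x \<noteq> 0\<close> by auto
        then have "cmod c < cmod x" using c(2) expanding by (simp add: norm_mult)
        then have "halts c" using smaller c(1) x(2) by simp
        then have "halts x" using halts_steps[of 1 x] c by (simp add: naf_step_mult)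
        with x(3) show False by simp
      qed
      have Z': "x' \<in> Z_adjoin \<tau>" using naf_steps_in_Z x(1) x' by simp
      have nh: "\<not> halts x'" using halts_steps x(3) x' by blast
      then have "\<not> cmod x' < cmod x" using smaller Z' x(2) by auto
      then show ?thesis using naf_steps_contract[OF x(1) nd] nd Z' nh x' x(2) by auto
    qed
    show ?case
    proof (rule ccontr)
      assume nh: "\<not> halts y"
      define y1 where "y1 = (naf_step \<tau> w ^^ w) y"
      define y2 where "y2 = (naf_step \<tau> w ^^ w) y1"
      define y3 where "y3 = (naf_step \<tau> w ^^ w) y2"
      note s1 = stuck[OF less.prems(2) refl nh y1_def]
      then have s2: "\<not> Z_dvd \<tau> \<tau> y1 \<and> y2 \<in> Z_adjoin \<tau> \<and> cmod y2 = cmod y \<and> \<not> halts y2 \<and>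
        q = 2 \<and> \<tau>\<^sup>2 * y2 = 2 * y1 \<and> - y2 / 2 \<in> restricted_voronoi \<tau>"
        by (intro stuck[OF _ _ _ y2_def]) auto
      then have s3: "\<tau>\<^sup>2 * y3 = 2 * y2 \<and> - y3 / 2 \<in> restricted_voronoi \<tau>"
        using stuck[OF _ _ _ y3_def] by auto
      show False
        using not_stuck_thrice[of y y1 y2 y3] less.prems(2) s1 s2 s3 by auto
    qed
  qed
  then show ?thesis by (simp add: halts_def)
qed

section \<open>The digit sequence of the loop, its uniqueness, and the output\<close>

definition naf_digit :: "complex \<Rightarrow> nat \<Rightarrow> complex" where
  "naf_digit z k = next_digit \<tau> w ((naf_step \<tau> w ^^ k) z)"

definition naf_seq :: "complex \<Rightarrow> int \<Rightarrow> complex" where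
  "naf_seq z j = (if j < 0 then 0 else naf_digit z (nat j))"

lemma naf_steps_0: "(naf_step \<tau> w ^^ k) 0 = 0"
  by (induction k) (auto simp: naf_step_def next_digit_def tau_dvd_0)

lemma naf_digit_eq_0:
  assumes "(naf_step \<tau> w ^^ n) z = 0" "n \<le> k"
  shows "naf_digit z k = 0"
proof -
  have "(naf_step \<tau> w ^^ k) z = (naf_step \<tau> w ^^ (k - n)) ((naf_step \<tau> w ^^ n) z)"
    using assms(2) by (metis funpow_add le_add_diff_inverse2 o_apply)
  then have "(naf_step \<tau> w ^^ k) z = 0"
    using assms(1) by (simp add: naf_steps_0)
  then show ?thesis by (simp add: naf_digit_def next_digit_def tau_dvd_0)
qed

lemma naf_value_eq_sum:
  assumes "\<And>j. j < 0 \<Longrightarrow> \<xi> j = 0" "\<And>k. k \<ge> n \<Longrightarrow> \<xi> (int k) = 0"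
  shows "naf_value \<tau> \<xi> = (\<Sum>k<n. \<xi> (int k) * \<tau> ^ k)"
proof -
  have "naf_value \<tau> \<xi> = (\<Sum>\<^sub>\<infinity>j\<in>int ` {..<n}. \<xi> j * \<tau> powi j)"
    unfolding naf_value_def
  proof (rule infsum_cong_neutral)
    fix j assume "j \<in> UNIV - int ` {..<n}"
    then have "j < 0 \<or> (\<exists>k\<ge>n. j = int k)"
      by (metis DiffD2 image_eqI lessThan_iff nonneg_int_cases not_le)
    then show "\<xi> j * \<tau> powi j = 0" using assms by auto
  qed auto
  also have "\<dots> = (\<Sum>k<n. \<xi> (int k) * \<tau> ^ k)"
    by (simp add: sum.reindex)
  finally show ?thesis .
qed

text \<open>The loop invariant: digits produced so far plus the shifted remainder.\<close>

lemma sum_naf_digits: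
  "z = (\<Sum>k<n. naf_digit z k * \<tau> ^ k) + \<tau> ^ n * (naf_step \<tau> w ^^ n) z"
proof (induction n)
  case (Suc n)
  have "(naf_step \<tau> w ^^ n) z = naf_digit z n + \<tau> * (naf_step \<tau> w ^^ Suc n) z"
    using tau_nz by (simp add: naf_digit_def naf_step_def)
  then have "\<tau> ^ n * (naf_step \<tau> w ^^ n) z = \<tau> ^ n * (naf_digit z n + \<tau> * (naf_step \<tau> w ^^ Suc n) z)"
    by (rule arg_cong)
  also have "\<dots> = naf_digit z n * \<tau> ^ n + \<tau> ^ Suc n * (naf_step \<tau> w ^^ Suc n) z"
    by (simp add: algebra_simps)
  finally have "\<tau> ^ n * (naf_step \<tau> w ^^ n) z = naf_digit z n * \<tau> ^ n + \<tau> ^ Suc n * (naf_step \<tau> w ^^ Suc n) z" .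
  then show ?case
    using Suc by (simp only: sum.lessThan_Suc add.assoc)
qed simp

lemma naf_seq_value:
  assumes "z \<in> Z_adjoin \<tau>"
  shows "naf_value \<tau> (naf_seq z) = z"
proof -
  obtain n where n: "(naf_step \<tau> w ^^ n) z = 0" using naf_terminates[OF assms] by blast
  have "naf_value \<tau> (naf_seq z) = (\<Sum>k<n. naf_seq z (int k) * \<tau> ^ k)"
    using n by (intro naf_value_eq_sum) (auto simp: naf_seq_def naf_digit_eq_0)
  also have "\<dots> = z"
    using sum_naf_digits[of z n] n by (simp add: naf_seq_def)
  finally show ?thesis .
qed

lemma naf_seq_wNAF:
  assumes z: "z \<in> Z_adjoin \<tau>"
  shows "naf_seq z \<in> wNAF_fin0 w (digits \<tau> w)"
proof -
  obtain n where n: "(naf_step \<tau> w ^^ n) z = 0" using naf_terminates[OF z] by blast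
  have sep: "naf_digit z j = 0" if "naf_digit z i \<noteq> 0" "i < j" "j < i + w" for i j
  proof -
    have "(naf_step \<tau> w ^^ j) z = (naf_step \<tau> w ^^ (j - i)) ((naf_step \<tau> w ^^ i) z)"
      using that(2) by (metis funpow_add le_add_diff_inverse2 less_imp_le o_apply)
    then show ?thesis
      using next_digit_after_nonzero[of "(naf_step \<tau> w ^^ i) z" "j - i"] naf_steps_in_Z[OF z] that
      by (simp add: naf_digit_def)
  qed
  have "card {j \<in> {k..<k + int w}. naf_seq z j \<noteq> 0} \<le> 1" for k
  proof -
    have no: False if "i < j" "j < i + int w" "naf_seq z i \<noteq> 0" "naf_seq z j \<noteq> 0" for i j
      using sep[of "nat i" "nat j"] that by (auto simp: naf_seq_def split: if_splits)
    have "i = j" if "i \<in> {k..<k + int w}" "j \<in> {k..<k + int w}" "naf_seq z i \<noteq> 0" "naf_seq z j \<noteq> 0" for i j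
      using that no[of i j] no[of j i] by (cases i j rule: linorder_cases) auto
    moreover have "finite {j \<in> {k..<k + int w}. naf_seq z j \<noteq> 0}"
      by (rule finite_subset[of _ "{k..<k + int w}"]) auto
    ultimately show ?thesis
      by (simp only: One_nat_def card_le_Suc0_iff_eq) blast
  qed
  moreover have "naf_seq z j \<in> digits \<tau> w" for j
    using next_digit_in_digits naf_steps_in_Z[OF z] by (simp add: naf_seq_def naf_digit_def in_digits_iff[of 0])
  moreover have "{j. naf_seq z j \<noteq> 0} \<subseteq> {0..<int n}"
  proof
    fix j assume "j \<in> {j. naf_seq z j \<noteq> 0}"
    then have "j \<ge> 0" "naf_digit z (nat j) \<noteq> 0" by (auto simp: naf_seq_def split: if_splits)
    with naf_digit_eq_0[OF n, of "nat j"] show "j \<in> {0..<int n}" by force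
  qed
  then have "finite {j. naf_seq z j \<noteq> 0}"
    by (rule finite_subset) simp
  ultimately show ?thesis
    by (simp add: wNAF_fin0_def is_wNAF_def naf_seq_def)
qed

text \<open>The algorithm applied to the value of a w-NAF reads off its digits again: the remainder
  after k steps is the value of the tail from position k.\<close>

lemma wNAF_unique:
  assumes \<xi>: "\<xi> \<in> wNAF_fin0 w (digits \<tau> w)"
  shows "\<xi> = naf_seq (naf_value \<tau> \<xi>)"
proof -
  have dig: "\<xi> j \<in> digits \<tau> w" and window: "card {j \<in> {k..<k + int w}. \<xi> j \<noteq> 0} \<le> 1"
    and neg: "j < 0 \<Longrightarrow> \<xi> j = 0" and fin: "finite {j. \<xi> j \<noteq> 0}" for j k
    using \<xi> by (auto simp: wNAF_fin0_def is_wNAF_def)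
  obtain M where M: "\<And>j. \<xi> j \<noteq> 0 \<Longrightarrow> j \<le> M"
    using fin by (metis (mono_tags) Max_ge mem_Collect_eq)
  define f where "f k = \<xi> (int k)" for k
  define N where "N = nat (M + 1)"
  have f0: "f k = 0" if "k \<ge> N" for k
    using M[of "int k"] that by (cases "\<xi> (int k) = 0") (auto simp: f_def N_def)
  \<comment> \<open>One cut-off N serves the tails from all positions, because f vanishes from N
    on.\<close>
  define T where "T k = (\<Sum>i<N. f (k + i) * \<tau> ^ i)" for k
  have T_Z: "T k \<in> Z_adjoin \<tau>" for k
  proof -
    have "(\<Sum>i<n. f (k + i) * \<tau> ^ i) \<in> Z_adjoin \<tau>" for n
    proof (induction n)
      case (Suc n)
      have "f (k + n) * \<tau> ^ n \<in> Z_adjoin \<tau>" using digits_subset dig by (auto simp: f_def)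
      with Suc show ?case by auto
    qed simp
    then show ?thesis by (simp add: T_def)
  qed
  have T_rec: "T k = f k + \<tau> * T (Suc k)" for k
  proof -
    have "T k = (\<Sum>i<Suc N. f (k + i) * \<tau> ^ i)" by (simp add: T_def f0)
    also have "\<dots> = f k + (\<Sum>i<N. f (k + Suc i) * \<tau> ^ Suc i)"
      by (simp only: sum.lessThan_Suc_shift) simp
    also have "\<dots> = f k + \<tau> * T (Suc k)"
      by (simp add: T_def sum_distrib_left mult.left_commute)
    finally show ?thesis .
  qed
  have f_sep: "f (k + i) = 0" if "f k \<noteq> 0" "0 < i" "i < w" for k i
  proof (rule ccontr)
    assume "f (k + i) \<noteq> 0"
    then have "{int k, int (k + i)} \<subseteq> {j \<in> {int k..<int k + int w}. \<xi> j \<noteq> 0}"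
      using that by (auto simp: f_def)
    then have "card {int k, int (k + i)} \<le> card {j \<in> {int k..<int k + int w}. \<xi> j \<noteq> 0}"
      by (rule card_mono[rotated]) (rule finite_subset[of _ "{int k..<int k + int w}"], auto)
    with window[of "int k"] that show False by simp
  qed
  have next_T: "next_digit \<tau> w (T k) = f k" for k
  proof (cases "f k = 0")
    case True
    then have "T k = \<tau> * T (Suc k)" using T_rec[of k] by simp
    then have "Z_dvd \<tau> \<tau> (T k)" using tau_dvd_mult T_Z by metis
    then show ?thesis using True by (simp add: next_digit_def)
  next
    case False
    \<comment> \<open>The w - 1 zeros after a nonzero digit make T k congruent to f k modulo
      \<tau>^w, which identifies the digit.\<close>
    have "m < w \<Longrightarrow> T k = f k + \<tau> ^ Suc m * T (k + Suc m)" for m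
    proof (induction m)
      case 0
      then show ?case using T_rec[of k] by simp
    next
      case (Suc m)
      have "T (k + Suc m) = \<tau> * T (k + Suc (Suc m))"
        using T_rec[of "k + Suc m"] f_sep[OF False, of "Suc m"] Suc.prems by simp
      then show ?case using Suc by (simp add: algebra_simps)
    qed
    from this[of "w - 1"] have "T k = f k + \<tau> ^ w * T (k + w)"
      using w_ge_2 by simp
    then have "f k = T k + \<tau> ^ w * (- T (k + w))" by simp
    then have cong: "Z_cong \<tau> w (f k) (T k)"
      unfolding cong_iff_mult using T_Z by blast
    have fk: "f k \<in> digits \<tau> w" using dig by (simp add: f_def)
    with False have "\<not> Z_dvd \<tau> \<tau> (f k)" by (simp add: in_digits_iff)
    then have "\<not> Z_dvd \<tau> \<tau> (T k)" using tau_dvd_cong[OF cong] w_ge_2 by simp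
    then show ?thesis using next_digit_eqI T_Z fk cong by blast
  qed
  have T_steps: "T k = (naf_step \<tau> w ^^ k) (T 0)" for k
  proof (induction k)
    case (Suc k)
    have "naf_step \<tau> w (T k) = (T k - f k) / \<tau>"
      by (simp add: naf_step_def next_T)
    also have "\<dots> = T (Suc k)"
      using T_rec[of k] tau_nz by simp
    finally show ?case using Suc by simp
  qed simp
  have "f k = naf_digit (T 0) k" for k
    unfolding naf_digit_def T_steps[symmetric] next_T ..
  moreover have "naf_value \<tau> \<xi> = T 0"
    using naf_value_eq_sum[of \<xi> N] neg f0 by (simp add: T_def f_def)
  ultimately show ?thesis
    using neg by (auto simp: naf_seq_def f_def fun_eq_iff) (metis nat_0_le not_less)
qed

text \<open>After k passes the first k array entries are the digits, so undefined entries never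
  reach the output. Beyond the stopping index the digits vanish, in agreement with the zero padding
  of \<open>word_seq\<close>.\<close>

lemma naf_algorithm_output:
  assumes "z \<in> Z_adjoin \<tau>"
  obtains ds where "naf_algorithm \<tau> w z = Some ds" "word_seq ds = naf_seq z"
proof -
  define b :: "(nat \<Rightarrow> complex) \<times> nat \<times> complex \<Rightarrow> bool" where "b = (\<lambda>(\<xi>, l, y). y \<noteq> 0)"
  define c :: "(nat \<Rightarrow> complex) \<times> nat \<times> complex \<Rightarrow> _" where
    "c = (\<lambda>(\<xi>, l, y). (\<xi>(l := next_digit \<tau> w y), l + 1, (y - next_digit \<tau> w y) / \<tau>))"
  define s :: "(nat \<Rightarrow> complex) \<times> nat \<times> complex" where "s = (\<lambda>_. undefined, 0, z)"
  have state: "\<exists>\<xi>. (c ^^ k) s = (\<xi>, k, (naf_step \<tau> w ^^ k) z) \<and> (\<forall>i<k. \<xi> i = naf_digit z i)" for k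
  proof (induction k)
    case (Suc k)
    then obtain \<xi> where "(c ^^ k) s = (\<xi>, k, (naf_step \<tau> w ^^ k) z)" "\<forall>i<k. \<xi> i = naf_digit z i"
      by blast
    moreover have "c (\<xi>, k, y) = (\<xi>(k := next_digit \<tau> w y), Suc k, naf_step \<tau> w y)" for y
      by (simp add: c_def naf_step_def)
    ultimately show ?case
      by (auto simp: naf_digit_def less_Suc_eq)
  qed (simp add: s_def)
  have b_iff: "\<not> b ((c ^^ k) s) \<longleftrightarrow> (naf_step \<tau> w ^^ k) z = 0" for k
    using state[of k] by (auto simp: b_def)
  \<comment> \<open>The stopping index in the form used by the definition of
    \<open>while_option\<close>.\<close>
  define n where "n = (LEAST k. \<not> b ((c ^^ k) s))"
  have ex: "\<exists>k. \<not> b ((c ^^ k) s)"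
    using naf_terminates[OF assms] b_iff by simp
  then have n: "(naf_step \<tau> w ^^ n) z = 0"
    using LeastI_ex[OF ex] b_iff by (simp add: n_def)
  obtain \<xi> where \<xi>: "(c ^^ n) s = (\<xi>, n, (naf_step \<tau> w ^^ n) z)" "\<forall>i<n. \<xi> i = naf_digit z i"
    using state by blast
  have "while_option b c s = Some (\<xi>, n, (naf_step \<tau> w ^^ n) z)"
    using ex \<xi>(1) by (simp add: while_option_def n_def)
  then have "naf_algorithm \<tau> w z = Some (rev (map \<xi> [0..<n]))"
    by (simp add: naf_algorithm_def b_def c_def s_def)
  moreover have "word_seq (rev (map \<xi> [0..<n])) = naf_seq z"
    using \<xi>(2) naf_digit_eq_0[OF n] by (auto simp: word_seq_def naf_seq_def fun_eq_iff)
  ultimately show thesis using that by blast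
qed

lemma ex1_wNAF:
  assumes "z \<in> Z_adjoin \<tau>"
  shows "\<exists>!\<xi>. \<xi> \<in> wNAF_fin0 w (digits \<tau> w) \<and> naf_value \<tau> \<xi> = z"
  using naf_seq_wNAF[OF assms] naf_seq_value[OF assms] wNAF_unique by metis

end

theorem theorem7p1:
  fixes p q :: int and \<tau> :: complex and w :: nat
  assumes "4 * q - p ^ 2 > 0"
    and "\<tau> ^ 2 - of_int p * \<tau> + of_int q = 0"
    and "cmod \<tau> > 1"
    and "w \<ge> 2"
  shows "(\<forall>z \<in> Z_adjoin \<tau>.
            \<exists>!\<xi>. \<xi> \<in> wNAF_fin0 w (digits \<tau> w) \<and> naf_value \<tau> \<xi> = z)
       \<and> wNADS \<tau> w (digits \<tau> w)
       \<and> (\<forall>z \<in> Z_adjoin \<tau>. \<exists>ds. naf_algorithm \<tau> w z = Some ds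
            \<and> word_seq ds \<in> wNAF_fin0 w (digits \<tau> w) \<and> naf_value \<tau> (word_seq ds) = z)"
proof -
  interpret naf_base p q \<tau> w
    using assms by unfold_locales
  have "\<exists>ds. naf_algorithm \<tau> w z = Some ds \<and> word_seq ds \<in> wNAF_fin0 w (digits \<tau> w)
      \<and> naf_value \<tau> (word_seq ds) = z" if "z \<in> Z_adjoin \<tau>" for z
  proof -
    obtain ds where "naf_algorithm \<tau> w z = Some ds" "word_seq ds = naf_seq z"
      using naf_algorithm_output[OF \<open>z \<in> Z_adjoin \<tau>\<close>] .
    then show ?thesis using naf_seq_wNAF[OF that] naf_seq_value[OF that] by auto
  qed
  then show ?thesis
    using ex1_wNAF by (simp add: wNADS_def)
qed

end
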